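(* The system $\mathsf{ACA}_0^\omega+\Sigma\text{-}\mathsf{IND}$ proves the equivalence $\mathsf{ENC}^\omega\leftrightarrow[\mathsf{BNC}^\omega+\Phi_1\text{-}\mathsf{KL}]$.
   Context: Framework. $\mathsf{RCA}_0^\omega$ is Kohlenbach's base theory of higher-order reverse mathematics: the classical theory in the language of all finite types (type $0$ is $\mathbb N$, type $1$ is $\mathbb N^{\mathbb N}$, type $2$ is $\mathbb N^{\mathbb N}\to\mathbb N$, etc.) with the basic axioms of arithmetic, quantifier-free induction, the defining axioms of the typed combinators ($\lambda$-abstraction) and of primitive recursion at type $0$ only, the axiom of extensionality at all types, and $\mathsf{QF}\text{-}\mathsf{AC}^{1,0}$: for quantifier-free $\varphi$, $(\forall f\in\mathbb N^{\mathbb N})(\exists n\in\mathbb N)\varphi(f,n)\to(\exists Y:\mathbb N^{\mathbb N}\to\mathbb N)(\forall f)\varphi(f,Y(f))$. $\mathsf{ACA}_0^\omega$ is $\mathsf{RCA}_0^\omega$ plus $(\exists^2)$: there is $E:\mathbb N^{\mathbb N}\to\{0,1\}$ with $(\forall f\in\mathbb N^{\mathbb N})(E(f)=0\leftrightarrow(\exists n\in\mathbb N)(f(n)=0))$. $\Sigma\text{-}\mathsf{IND}$: the induction axiom for formulas $\varphi(n)\equiv(\exists f\in\mathbb N^{\mathbb N})(Y(f,n)=0)$, for any third-order $Y$. Arithmetical formulas contain only number quantifiers but may have parameters of higher type. For formulas $\varphi(n,m)$ of the form $(\forall f\in\mathbb N^{\mathbb N})\psi(f,n,m)$ with $\psi$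 arithmetical: $\mathsf{ENC}^\omega$: $(\forall n\in\mathbb N)(\exists m\in\mathbb N)\varphi(n,m)\to(\exists g\in\mathbb N^{\mathbb N})(\forall n)\varphi(n,g(n))$. $\mathsf{BNC}^\omega$: $(\forall n\in\mathbb N)(\exists m\in\mathbb N)\varphi(n,m)\to(\exists g\in\mathbb N^{\mathbb N})(\forall n)(\exists m\le g(n))\varphi(n,m)$. For $f\in\mathbb N^{\mathbb N}$, $\overline fn$ denotes $\langle f(0),\dots,f(n-1)\rangle$. A formula $A(\sigma)$ on finite sequences $\sigma$ of naturals is finitely branching if for every $\sigma$: $A(\sigma)\to(\exists n\in\mathbb N)(\forall m\in\mathbb N)[A(\sigma*\langle m\rangle)\to m\le n]$, where $*$ is concatenation. $\Phi_1\text{-}\mathsf{KL}$: let $A(\sigma)$ have the form $(\forall g\in2^{\mathbb N})B(g,\sigma)$ with $B$ arithmetical. If $A$ is finitely branching, then $(\forall n\in\mathbb N)(\exists f\in\mathbb N^{\mathbb N})(\forall m\le n)A(\overline fm)\to(\exists f\in\mathbb N^{\mathbb N})(\forall n\in\mathbb N)A(\overline fn)$. *)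

theory Defs
  imports Main
begin

section \<open>The language of all finite types\<close>

text \<open>
  \<open>N\<close> is the type \<open>0\<close> of natural numbers, and functions of several arguments are curried.
  Variables carry their type.  Binding is by de Bruijn indices that are counted separately for
  every type: a quantifier over type \<open>\<tau>\<close> binds the variable \<open>Var \<tau> 0\<close> and shifts only the
  variables of type \<open>\<tau>\<close>.
\<close>

datatype ftype = N | Arr ftype ftype  (infixr "\<rightarrow>" 65)

abbreviation T1 :: ftype where "T1 \<equiv> N \<rightarrow> N"
abbreviation T2 :: ftype where "T2 \<equiv> T1 \<rightarrow> N"

datatype const =
    CZero | CSuc | CPlus | CTimes
  | CK ftype ftype
  | CS ftype ftype ftype
  | CRec

primrec cty :: "const \<Rightarrow> ftype" where
  "cty CZero = N"
| "cty CSuc = T1"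
| "cty CPlus = N \<rightarrow> N \<rightarrow> N"
| "cty CTimes = N \<rightarrow> N \<rightarrow> N"
| "cty (CK \<sigma> \<tau>) = \<sigma> \<rightarrow> \<tau> \<rightarrow> \<sigma>"
| "cty (CS \<rho> \<sigma> \<tau>) = (\<rho> \<rightarrow> \<sigma> \<rightarrow> \<tau>) \<rightarrow> (\<rho> \<rightarrow> \<sigma>) \<rightarrow> \<rho> \<rightarrow> \<tau>"
| "cty CRec = (N \<rightarrow> N \<rightarrow> N) \<rightarrow> N \<rightarrow> N \<rightarrow> N"

datatype trm = Var ftype nat | Con const | App trm trm  (infixl "\<cdot>" 100)

primrec ty :: "trm \<Rightarrow> ftype option" where
  "ty (Var \<tau> i) = Some \<tau>"
| "ty (Con c) = Some (cty c)"
| "ty (t \<cdot> u) = (case ty t of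
       Some (\<sigma> \<rightarrow> \<tau>) \<Rightarrow> if ty u = Some \<sigma> then Some \<tau> else None
     | _ \<Rightarrow> None)"

abbreviation Zer :: trm where "Zer \<equiv> Con CZero"
abbreviation Sc :: "trm \<Rightarrow> trm" where "Sc t \<equiv> Con CSuc \<cdot> t"
abbreviation Plus :: "trm \<Rightarrow> trm \<Rightarrow> trm" where "Plus s t \<equiv> Con CPlus \<cdot> s \<cdot> t"
abbreviation Times :: "trm \<Rightarrow> trm \<Rightarrow> trm" where "Times s t \<equiv> Con CTimes \<cdot> s \<cdot> t"
abbreviation Rec :: "trm \<Rightarrow> trm \<Rightarrow> trm \<Rightarrow> trm" where "Rec f a n \<equiv> Con CRec \<cdot> f \<cdot> a \<cdot> n"

text \<open>Equality is primitive at type \<open>0\<close> only; the logic is classical, so the remaining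
  connectives are definable.\<close>

datatype fm = Eq trm trm | Less trm trm | Fls | Imp fm fm | Forall ftype fm

abbreviation Neg :: "fm \<Rightarrow> fm" where "Neg \<phi> \<equiv> Imp \<phi> Fls"
abbreviation Or :: "fm \<Rightarrow> fm \<Rightarrow> fm" where "Or \<phi> \<psi> \<equiv> Imp (Neg \<phi>) \<psi>"
abbreviation And :: "fm \<Rightarrow> fm \<Rightarrow> fm" where "And \<phi> \<psi> \<equiv> Neg (Imp \<phi> (Neg \<psi>))"
abbreviation Iff :: "fm \<Rightarrow> fm \<Rightarrow> fm" where "Iff \<phi> \<psi> \<equiv> And (Imp \<phi> \<psi>) (Imp \<psi> \<phi>)"
abbreviation Exists :: "ftype \<Rightarrow> fm \<Rightarrow> fm" where "Exists \<tau> \<phi> \<equiv> Neg (Forall \<tau> (Neg \<phi>))"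
abbreviation Leq :: "trm \<Rightarrow> trm \<Rightarrow> fm" where "Leq s t \<equiv> Or (Less s t) (Eq s t)"

primrec wff :: "fm \<Rightarrow> bool" where
  "wff (Eq s t) \<longleftrightarrow> ty s = Some N \<and> ty t = Some N"
| "wff (Less s t) \<longleftrightarrow> ty s = Some N \<and> ty t = Some N"
| "wff Fls \<longleftrightarrow> True"
| "wff (Imp \<phi> \<psi>) \<longleftrightarrow> wff \<phi> \<and> wff \<psi>"
| "wff (Forall \<tau> \<phi>) \<longleftrightarrow> wff \<phi>"

primrec qfree :: "fm \<Rightarrow> bool" where
  "qfree (Eq s t) \<longleftrightarrow> True"
| "qfree (Less s t) \<longleftrightarrow> True"
| "qfree Fls \<longleftrightarrow> True"
| "qfree (Imp \<phi> \<psi>) \<longleftrightarrow> qfree \<phi> \<and> qfree \<psi>"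
| "qfree (Forall \<tau> \<phi>) \<longleftrightarrow> False"

text \<open>Only number quantifiers, but the atomic formulas may contain variables of any type.\<close>

primrec arithmetical :: "fm \<Rightarrow> bool" where
  "arithmetical (Eq s t) \<longleftrightarrow> True"
| "arithmetical (Less s t) \<longleftrightarrow> True"
| "arithmetical Fls \<longleftrightarrow> True"
| "arithmetical (Imp \<phi> \<psi>) \<longleftrightarrow> arithmetical \<phi> \<and> arithmetical \<psi>"
| "arithmetical (Forall \<tau> \<phi>) \<longleftrightarrow> \<tau> = N \<and> arithmetical \<phi>"


section \<open>Substitution\<close>

type_synonym sub = "ftype \<Rightarrow> nat \<Rightarrow> trm"

text \<open>The shift of all variables below new binders of the types listed in \<open>bs\<close>.\<close>

definition up :: "ftype list \<Rightarrow> sub" where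
  "up bs = (\<lambda>\<tau> i. Var \<tau> (i + count_list bs \<tau>))"

definition scons :: "ftype \<times> trm \<Rightarrow> sub \<Rightarrow> sub" where
  "scons p \<theta> = (\<lambda>\<sigma> i. if \<sigma> = fst p then (case i of 0 \<Rightarrow> snd p | Suc j \<Rightarrow> \<theta> \<sigma> j) else \<theta> \<sigma> i)"

primrec tsubst :: "sub \<Rightarrow> trm \<Rightarrow> trm" where
  "tsubst \<theta> (Var \<tau> i) = \<theta> \<tau> i"
| "tsubst \<theta> (Con c) = Con c"
| "tsubst \<theta> (t \<cdot> u) = tsubst \<theta> t \<cdot> tsubst \<theta> u"

definition under :: "ftype \<Rightarrow> sub \<Rightarrow> sub" where
  "under \<tau> \<theta> = scons (\<tau>, Var \<tau> 0) (\<lambda>\<sigma> i. tsubst (up [\<tau>]) (\<theta> \<sigma> i))"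

primrec subst :: "sub \<Rightarrow> fm \<Rightarrow> fm" where
  "subst \<theta> (Eq s t) = Eq (tsubst \<theta> s) (tsubst \<theta> t)"
| "subst \<theta> (Less s t) = Less (tsubst \<theta> s) (tsubst \<theta> t)"
| "subst \<theta> Fls = Fls"
| "subst \<theta> (Imp \<phi> \<psi>) = Imp (subst \<theta> \<phi>) (subst \<theta> \<psi>)"
| "subst \<theta> (Forall \<tau> \<phi>) = Forall \<tau> (subst (under \<tau> \<theta>) \<phi>)"

text \<open>
  \<open>inst ps bs \<phi>\<close> is \<open>\<phi>\<close> with its distinguished variables replaced by the terms in \<open>ps\<close>, placed
  below the binders \<open>bs\<close>.  Per type, the first pair in \<open>ps\<close> replaces index \<open>0\<close>, the second one
  index \<open>1\<close>, and so on; every other variable is a parameter, i.e. it keeps referring to the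
  context outside \<open>bs\<close>.
\<close>

definition inst :: "(ftype \<times> trm) list \<Rightarrow> ftype list \<Rightarrow> fm \<Rightarrow> fm" where
  "inst ps bs = subst (foldr scons ps (up bs))"

abbreviation lift :: "ftype \<Rightarrow> fm \<Rightarrow> fm" where
  "lift \<tau> \<equiv> inst [] [\<tau>]"


section \<open>Classical logic with equality at type 0\<close>

text \<open>The formulas in \<open>T\<close> are axioms, so their free variables are implicitly universally
  quantified; free variables of the hypotheses \<open>\<Gamma>\<close> are not.\<close>

inductive nd :: "fm set \<Rightarrow> fm list \<Rightarrow> fm \<Rightarrow> bool" for T :: "fm set" where
  Axm: "\<phi> \<in> T \<Longrightarrow> nd T \<Gamma> \<phi>"
| Hyp: "\<phi> \<in> set \<Gamma> \<Longrightarrow> nd T \<Gamma> \<phi>"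
| ImpI: "wff \<phi> \<Longrightarrow> nd T (\<phi> # \<Gamma>) \<psi> \<Longrightarrow> nd T \<Gamma> (Imp \<phi> \<psi>)"
| ImpE: "nd T \<Gamma> (Imp \<phi> \<psi>) \<Longrightarrow> nd T \<Gamma> \<phi> \<Longrightarrow> nd T \<Gamma> \<psi>"
| Raa: "wff \<phi> \<Longrightarrow> nd T (Neg \<phi> # \<Gamma>) Fls \<Longrightarrow> nd T \<Gamma> \<phi>"
| AllI: "nd T (map (lift \<tau>) \<Gamma>) \<phi> \<Longrightarrow> nd T \<Gamma> (Forall \<tau> \<phi>)"
| AllE: "nd T \<Gamma> (Forall \<tau> \<phi>) \<Longrightarrow> ty t = Some \<tau> \<Longrightarrow> nd T \<Gamma> (inst [(\<tau>, t)] [] \<phi>)"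
| EqI: "ty t = Some N \<Longrightarrow> nd T \<Gamma> (Eq t t)"
| EqE: "wff \<phi> \<Longrightarrow> nd T \<Gamma> (Eq s t) \<Longrightarrow> nd T \<Gamma> (inst [(N, s)] [] \<phi>) \<Longrightarrow> nd T \<Gamma> (inst [(N, t)] [] \<phi>)"

definition proves :: "fm set \<Rightarrow> fm \<Rightarrow> bool"  (infix "\<turnstile>" 50) where
  "T \<turnstile> \<phi> \<longleftrightarrow> nd T [] \<phi>"

text \<open>Axiom schemes are identified with the sets of their instances.  Two schemes are equivalent
  over \<open>T\<close> if adding either of them to \<open>T\<close> proves every instance of the other.\<close>

definition proves_equivalence :: "fm set \<Rightarrow> fm set \<Rightarrow> fm set \<Rightarrow> bool" where
  "proves_equivalence T S S' \<longleftrightarrow> (\<forall>\<phi>\<in>S'. T \<union> S \<turnstile> \<phi>) \<and> (\<forall>\<phi>\<in>S. T \<union> S' \<turnstile> \<phi>)"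


section \<open>The base theories\<close>

text \<open>Equality at higher types is the defined, extensional one.\<close>

primrec Eqt :: "ftype \<Rightarrow> trm \<Rightarrow> trm \<Rightarrow> fm" where
  "Eqt N = Eq"
| "Eqt (\<sigma> \<rightarrow> \<tau>) = (\<lambda>s t. Forall \<sigma> (Eqt \<tau> (tsubst (up [\<sigma>]) s \<cdot> Var \<sigma> 0) (tsubst (up [\<sigma>]) t \<cdot> Var \<sigma> 0)))"

inductive_set RCA0w :: "fm set" where
  Suc_nonzero: "ty x = Some N \<Longrightarrow> Neg (Eq (Sc x) Zer) \<in> RCA0w"
| Suc_inject: "ty x = Some N \<Longrightarrow> ty y = Some N \<Longrightarrow> Imp (Eq (Sc x) (Sc y)) (Eq x y) \<in> RCA0w"
| Plus_0: "ty x = Some N \<Longrightarrow> Eq (Plus x Zer) x \<in> RCA0w"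
| Plus_Suc: "ty x = Some N \<Longrightarrow> ty y = Some N \<Longrightarrow> Eq (Plus x (Sc y)) (Sc (Plus x y)) \<in> RCA0w"
| Times_0: "ty x = Some N \<Longrightarrow> Eq (Times x Zer) Zer \<in> RCA0w"
| Times_Suc: "ty x = Some N \<Longrightarrow> ty y = Some N
    \<Longrightarrow> Eq (Times x (Sc y)) (Plus (Times x y) x) \<in> RCA0w"
| Less_0: "ty x = Some N \<Longrightarrow> Neg (Less x Zer) \<in> RCA0w"
| Less_Suc: "ty x = Some N \<Longrightarrow> ty y = Some N
    \<Longrightarrow> Iff (Less x (Sc y)) (Or (Less x y) (Eq x y)) \<in> RCA0w"
| K_ax: "ty x = Some \<sigma> \<Longrightarrow> ty y = Some \<tau> \<Longrightarrow> Eqt \<sigma> (Con (CK \<sigma> \<tau>) \<cdot> x \<cdot> y) x \<in> RCA0w"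
| S_ax: "ty x = Some (\<rho> \<rightarrow> \<sigma> \<rightarrow> \<tau>) \<Longrightarrow> ty y = Some (\<rho> \<rightarrow> \<sigma>) \<Longrightarrow> ty z = Some \<rho>
    \<Longrightarrow> Eqt \<tau> (Con (CS \<rho> \<sigma> \<tau>) \<cdot> x \<cdot> y \<cdot> z) (x \<cdot> z \<cdot> (y \<cdot> z)) \<in> RCA0w"
| Rec_0: "ty f = Some (N \<rightarrow> N \<rightarrow> N) \<Longrightarrow> ty a = Some N \<Longrightarrow> Eq (Rec f a Zer) a \<in> RCA0w"
| Rec_Suc: "ty f = Some (N \<rightarrow> N \<rightarrow> N) \<Longrightarrow> ty a = Some N \<Longrightarrow> ty n = Some N
    \<Longrightarrow> Eq (Rec f a (Sc n)) (f \<cdot> n \<cdot> Rec f a n) \<in> RCA0w"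
| Extensionality: "ty x = Some \<rho> \<Longrightarrow> ty y = Some \<rho> \<Longrightarrow> ty F = Some (\<rho> \<rightarrow> \<tau>)
    \<Longrightarrow> Imp (Eqt \<rho> x y) (Eqt \<tau> (F \<cdot> x) (F \<cdot> y)) \<in> RCA0w"
| QF_IND: "wff \<phi> \<Longrightarrow> qfree \<phi>
    \<Longrightarrow> Imp (And (inst [(N, Zer)] [] \<phi>)
                (Forall N (Imp \<phi> (inst [(N, Sc (Var N 0))] [N] \<phi>))))
           (Forall N \<phi>) \<in> RCA0w"
\<comment> \<open>\<open>QF-AC\<^sup>1\<^sup>,\<^sup>0\<close> for \<open>\<phi>(f,n)\<close> with \<open>f = Var T1 0\<close> and \<open>n = Var N 0\<close>\<close>
| QF_AC10: "wff \<phi> \<Longrightarrow> qfree \<phi>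
    \<Longrightarrow> Imp (Forall T1 (Exists N \<phi>))
           (Exists T2 (Forall T1 (inst [(N, Var T2 0 \<cdot> Var T1 0), (T1, Var T1 0)] [T1, T2] \<phi>))) \<in> RCA0w"

text \<open>\<open>(\<exists>\<^sup>2)\<close>, with \<open>E = Var T2 0\<close>, \<open>f = Var T1 0\<close>, \<open>n = Var N 0\<close>.\<close>

definition Ex2 :: fm where
  "Ex2 = Exists T2 (Forall T1
     (And (Or (Eq (Var T2 0 \<cdot> Var T1 0) Zer) (Eq (Var T2 0 \<cdot> Var T1 0) (Sc Zer)))
          (Iff (Eq (Var T2 0 \<cdot> Var T1 0) Zer) (Exists N (Eq (Var T1 0 \<cdot> Var N 0) Zer)))))"

definition ACA0w :: "fm set" where
  "ACA0w = RCA0w \<union> {Ex2}"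

text \<open>\<open>Y(f,n)\<close> is \<open>Y \<cdot> f \<cdot> n\<close> for \<open>Y\<close> of type \<open>1 \<rightarrow> 0 \<rightarrow> 0\<close>.\<close>

definition Sigma_IND :: fm where
  "Sigma_IND =
    (let Y = Var (T1 \<rightarrow> N \<rightarrow> N) 0;
         \<phi> = (\<lambda>n. Exists T1 (Eq (Y \<cdot> Var T1 0 \<cdot> n) Zer))
     in Forall (T1 \<rightarrow> N \<rightarrow> N)
          (Imp (And (\<phi> Zer) (Forall N (Imp (\<phi> (Var N 0)) (\<phi> (Sc (Var N 0))))))
               (Forall N (\<phi> (Var N 0)))))"


section \<open>The schemes \<open>ENC\<close> and \<open>BNC\<close>\<close>

text \<open>In \<open>\<phi>(n,m)\<close> we have \<open>n = Var N 1\<close> and \<open>m = Var N 0\<close>; in \<open>\<psi>(f,n,m)\<close> moreover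
  \<open>f = Var T1 0\<close>.\<close>

definition ENC :: "fm set" where
  "ENC = {Imp (Forall N (Exists N \<phi>))
              (Exists T1 (Forall N (inst [(N, Var T1 0 \<cdot> Var N 0), (N, Var N 0)] [N, T1] \<phi>)))
          | \<phi> \<psi>. \<phi> = Forall T1 \<psi> \<and> wff \<psi> \<and> arithmetical \<psi>}"

definition BNC :: "fm set" where
  "BNC = {Imp (Forall N (Exists N \<phi>))
              (Exists T1 (Forall N (Exists N (And (Leq (Var N 0) (Var T1 0 \<cdot> Var N 1))
                                       (inst [(N, Var N 0), (N, Var N 1)] [N, N, T1] \<phi>)))))
          | \<phi> \<psi>. \<phi> = Forall T1 \<psi> \<and> wff \<psi> \<and> arithmetical \<psi>}"


section \<open>Finite sequences and \<open>\<Phi>\<^sub>1-KL\<close>\<close>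

text \<open>Bracket abstraction: \<open>lam \<rho> t\<close> is the function mapping \<open>Var \<rho> 0\<close> to \<open>t\<close>, with the usual
  shift of the other variables of type \<open>\<rho>\<close>.\<close>

definition Id_comb :: "ftype \<Rightarrow> trm" where
  "Id_comb \<rho> = Con (CS \<rho> (\<rho> \<rightarrow> \<rho>) \<rho>) \<cdot> Con (CK \<rho> (\<rho> \<rightarrow> \<rho>)) \<cdot> Con (CK \<rho> \<rho>)"

primrec lam :: "ftype \<Rightarrow> trm \<Rightarrow> trm" where
  "lam \<rho> (Var \<sigma> i) =
     (if \<sigma> = \<rho> then (case i of 0 \<Rightarrow> Id_comb \<rho> | Suc j \<Rightarrow> Con (CK \<rho> \<rho>) \<cdot> Var \<rho> j)
      else Con (CK \<sigma> \<rho>) \<cdot> Var \<sigma> i)"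
| "lam \<rho> (Con c) = Con (CK (cty c) \<rho>) \<cdot> Con c"
| "lam \<rho> (t \<cdot> u) = (case ty t of
       Some (\<sigma> \<rightarrow> \<tau>) \<Rightarrow> Con (CS \<rho> \<sigma> \<tau>) \<cdot> lam \<rho> t \<cdot> lam \<rho> u
     | _ \<Rightarrow> undefined)"

text \<open>
  Finite sequences are coded by \<open>\<langle>\<rangle> = 0\<close> and \<open>\<sigma> * \<langle>m\<rangle> = 1 + pair(\<sigma>, m)\<close>, where
  \<open>pair(x, y) = (0 + 1 + \<dots> + (x + y)) + y\<close> is Cantor's pairing bijection.  Every number codes
  exactly one finite sequence, so quantifiers over finite sequences are number quantifiers.
\<close>

definition tri_trm :: trm where
  "tri_trm = Con CRec \<cdot> lam N (lam N (Plus (Var N 0) (Sc (Var N 1)))) \<cdot> Zer"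

definition snoc_trm :: trm where
  "snoc_trm = lam N (lam N (Sc (Plus (tri_trm \<cdot> Plus (Var N 1) (Var N 0)) (Var N 0))))"

definition snoc :: "trm \<Rightarrow> trm \<Rightarrow> trm" where
  "snoc s m = snoc_trm \<cdot> s \<cdot> m"

text \<open>The code of the initial segment \<open>\<langle>f(0), \<dots>, f(n-1)\<rangle>\<close>.\<close>

definition seg_trm :: trm where
  "seg_trm = lam T1 (Con CRec \<cdot> lam N (lam N (snoc (Var N 0) (Var T1 0 \<cdot> Var N 1))) \<cdot> Zer)"

definition seg :: "trm \<Rightarrow> trm \<Rightarrow> trm" where
  "seg f n = seg_trm \<cdot> f \<cdot> n"

definition All_Cantor :: "fm \<Rightarrow> fm" where
  "All_Cantor B =
     Forall T1 (Imp (Forall N (Or (Eq (Var T1 0 \<cdot> Var N 0) Zer) (Eq (Var T1 0 \<cdot> Var N 0) (Sc Zer)))) B)"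

text \<open>In \<open>A(\<sigma>)\<close> we have \<open>\<sigma> = Var N 0\<close>.  Below, inside the three number quantifiers,
  \<open>\<sigma> = Var N 2\<close>, \<open>n = Var N 1\<close> and \<open>m = Var N 0\<close>.\<close>

definition finitely_branching :: "fm \<Rightarrow> fm" where
  "finitely_branching A =
     Forall N (Imp A
       (Exists N (Forall N (Imp (inst [(N, snoc (Var N 2) (Var N 0))] [N, N, N] A)
                         (Leq (Var N 0) (Var N 1))))))"

text \<open>\<open>B(g,\<sigma>)\<close> has \<open>g = Var T1 0\<close> and \<open>\<sigma> = Var N 0\<close>.\<close>

definition Phi1_KL :: "fm set" where
  "Phi1_KL = {Imp (finitely_branching A)
      (Imp (Forall N (Exists T1 (Forall N (Imp (Leq (Var N 0) (Var N 1))
                                     (inst [(N, seg (Var T1 0) (Var N 0))] [N, T1, N] A)))))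
           (Exists T1 (Forall N (inst [(N, seg (Var T1 0) (Var N 0))] [N, T1] A))))
    | A B. A = All_Cantor B \<and> wff B \<and> arithmetical B}"

end

theory Submission
  imports Defs "HOL-Library.Countable_Set"
begin

text \<open>
  By a Henkin argument a formula is derivable as soon as it holds in all models of the axioms,
  where extensionality lets us take models in which equality of objects of every type is true
  equality.  The equivalence is then proved inside such a (possibly nonstandard) model, in which
  \<open>(\<exists>\<^sup>2)\<close> and \<open>QF-AC\<^sup>1\<^sup>,\<^sup>0\<close> yield induction, comprehension and a choice operator for arithmetical
  predicates.

  From \<open>ENC\<close> one gets \<open>BNC\<close> at once.  For \<open>\<Phi>\<^sub>1-KL\<close>, use \<open>ENC\<close> to pick for every \<open>n\<close> a sequence of
  length \<open>n\<close> all of whose initial segments lie in the tree.  The initial segments of these sequences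
  form an arithmetical finitely branching subtree, to which the usual proof of Koenig's lemma applies.

  Conversely, let \<open>g\<close> bound solutions of \<open>\<forall>n \<exists>m \<phi>(n,m)\<close>.  The sequences whose last entry \<open>x\<close>, at
  position \<open>n\<close>, satisfies \<open>x \<le> g(n)\<close> and \<open>\<phi>(n,x)\<close> form a finitely branching tree, the function
  quantifier in \<open>\<phi>\<close> being coded by graphs in Cantor space, and every infinite path solves the problem.
  That the tree contains finite paths of every length \<open>n\<close> follows from \<open>\<Sigma>-IND\<close>: call \<open>t\<close> low if
  \<open>\<not> \<phi>(i,m)\<close> for all \<open>i < n\<close> and \<open>m < t(i)\<close>.  The sums of low sequences are bounded by that of \<open>g\<close>, and a
  low sequence whose sum cannot be increased by one consists of solutions.
\<close>

section \<open>Substitution\<close>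

definition wts :: "sub \<Rightarrow> bool" where
  "wts \<theta> \<longleftrightarrow> (\<forall>\<sigma> i. ty (\<theta> \<sigma> i) = Some \<sigma>)"

lemma ty_tsubst [simp]: "wts \<theta> \<Longrightarrow> ty (tsubst \<theta> t) = ty t"
  by (induction t) (auto simp: wts_def cong: option.case_cong ftype.case_cong)

lemma tsubst_tsubst: "tsubst \<theta> (tsubst \<theta>' t) = tsubst (\<lambda>\<sigma> i. tsubst \<theta> (\<theta>' \<sigma> i)) t"
  by (induction t) auto

lemma tsubst_Var [simp]: "tsubst Var t = t"
  by (induction t) auto

lemma wts_Var [simp]: "wts Var"
  by (simp add: wts_def)

lemma wts_up [simp]: "wts (up bs)"
  by (simp add: wts_def up_def)

lemma up_Nil [simp]: "up [] = Var"
  by (simp add: up_def)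

lemma wts_scons [simp]: "wts \<theta> \<Longrightarrow> ty t = Some \<tau> \<Longrightarrow> wts (scons (\<tau>, t) \<theta>)"
  by (auto simp: wts_def scons_def split: nat.splits)

lemma wts_under [simp]: "wts \<theta> \<Longrightarrow> wts (under \<tau> \<theta>)"
  using ty_tsubst[OF wts_up[of "[\<tau>]"]] unfolding under_def
  by (intro wts_scons) (simp_all add: wts_def del: ty_tsubst)

text \<open>A shifted term never mentions the new bound index, so \<open>under\<close> acts on it
  through \<open>\<theta>\<close> alone.\<close>

lemma under_up: "tsubst (under \<tau> \<theta>) (tsubst (up [\<tau>]) t) = tsubst (up [\<tau>]) (tsubst \<theta> t)"
  unfolding tsubst_tsubst
  by (rule arg_cong2[where f = tsubst]) (auto simp: under_def up_def scons_def fun_eq_iff)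

lemma under_comp:
  "(\<lambda>\<sigma> i. tsubst (under \<tau> \<theta>) (under \<tau> \<theta>' \<sigma> i)) = under \<tau> (\<lambda>\<sigma> i. tsubst \<theta> (\<theta>' \<sigma> i))"
proof (intro ext)
  fix \<sigma> i
  have "under \<tau> \<theta> \<tau> 0 = Var \<tau> 0" by (simp add: under_def scons_def)
  then show "tsubst (under \<tau> \<theta>) (under \<tau> \<theta>' \<sigma> i) = under \<tau> (\<lambda>\<sigma> i. tsubst \<theta> (\<theta>' \<sigma> i)) \<sigma> i"
    using under_up[of \<tau> \<theta>]
    by (simp add: under_def[of _ \<theta>'] under_def[of _ "\<lambda>\<sigma> i. tsubst \<theta> (\<theta>' \<sigma> i)"] scons_def split: nat.splits)
qed

lemma subst_subst: "subst \<theta> (subst \<theta>' \<phi>) = subst (\<lambda>\<sigma> i. tsubst \<theta> (\<theta>' \<sigma> i)) \<phi>"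
  by (induction \<phi> arbitrary: \<theta> \<theta>') (auto simp: tsubst_tsubst under_comp)

lemma under_Var [simp]: "under \<tau> Var = Var"
  by (auto simp: under_def scons_def up_def fun_eq_iff split: nat.splits)

lemma subst_Var [simp]: "subst Var \<phi> = \<phi>"
  by (induction \<phi>) auto

lemma wff_subst [simp]: "wts \<theta> \<Longrightarrow> wff (subst \<theta> \<phi>) = wff \<phi>"
  by (induction \<phi> arbitrary: \<theta>) auto

lemma tsubst_scons_up: "tsubst (scons (\<tau>, t) Var) (tsubst (up [\<tau>]) u) = u"
  unfolding tsubst_tsubst
  by (rule trans[OF _ tsubst_Var], rule arg_cong2[where f = tsubst])
    (auto simp: up_def scons_def fun_eq_iff)

text \<open>Weakening followed by instantiation cancels. Hence instantiating the bound variable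
  after pushing \<open>\<theta>\<close> under the binder is one simultaneous substitution, which is
  the form needed for \<open>AllE\<close>.\<close>

lemma scons_under:
  "(\<lambda>\<sigma> i. tsubst (scons (\<tau>, t) Var) (under \<tau> \<theta> \<sigma> i)) = scons (\<tau>, t) \<theta>"
proof -
  have "scons (\<tau>, t) Var \<tau> 0 = t" by (simp add: scons_def)
  then show ?thesis
    unfolding under_def using tsubst_scons_up[of \<tau> t] by (auto simp: scons_def[of _ "\<lambda>\<sigma> i. tsubst (up [\<tau>]) (\<theta> \<sigma> i)"]
        scons_def[of _ \<theta>] fun_eq_iff split: nat.splits)
qed

lemma inst1_under: "inst [(\<tau>, t)] [] (subst (under \<tau> \<theta>) \<phi>) = subst (scons (\<tau>, t) \<theta>) \<phi>"
  by (simp add: inst_def subst_subst scons_under)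

lemma subst_inst1:
  "subst \<theta> (inst [(\<tau>, t)] [] \<phi>) = inst [(\<tau>, tsubst \<theta> t)] [] (subst (under \<tau> \<theta>) \<phi>)"
proof -
  have "(\<lambda>\<sigma> i. tsubst \<theta> (scons (\<tau>, t) Var \<sigma> i)) = scons (\<tau>, tsubst \<theta> t) \<theta>"
    by (auto simp: scons_def fun_eq_iff split: nat.splits)
  then show ?thesis
    by (simp add: inst1_under) (simp add: inst_def subst_subst)
qed

lemma subst_lift: "subst (under \<tau> \<theta>) (lift \<tau> \<phi>) = lift \<tau> (subst \<theta> \<phi>)"
proof -
  have "(\<lambda>\<sigma> i. tsubst (under \<tau> \<theta>) (up [\<tau>] \<sigma> i)) = (\<lambda>\<sigma> i. tsubst (up [\<tau>]) (\<theta> \<sigma> i))"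
    using under_up[of \<tau> \<theta> "Var _ _"] by simp
  then show ?thesis by (simp add: inst_def subst_subst)
qed

lemma wff_inst1 [simp]: "ty t = Some \<tau> \<Longrightarrow> wff (inst [(\<tau>, t)] [] \<phi>) = wff \<phi>"
  by (simp add: inst_def)

section \<open>Free variables and universal closures\<close>

primrec tvs :: "trm \<Rightarrow> (ftype \<times> nat) set" where
  "tvs (Var \<tau> i) = {(\<tau>, i)}"
| "tvs (Con c) = {}"
| "tvs (t \<cdot> u) = tvs t \<union> tvs u"

text \<open>Taking the preimage under the shift lowers the indices of type \<open>\<tau>\<close> and
  at the same time drops the bound index, which lies outside the range of the shift.\<close>

primrec fvs :: "fm \<Rightarrow> (ftype \<times> nat) set" where
  "fvs (Eq s t) = tvs s \<union> tvs t"
| "fvs (Less s t) = tvs s \<union> tvs t"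
| "fvs Fls = {}"
| "fvs (Imp \<phi> \<psi>) = fvs \<phi> \<union> fvs \<psi>"
| "fvs (Forall \<tau> \<phi>) = (\<lambda>(\<sigma>, i). (\<sigma>, if \<sigma> = \<tau> then Suc i else i)) -` fvs \<phi>"

lemma finite_tvs [simp]: "finite (tvs t)"
  by (induction t) auto

lemma finite_fvs [simp]: "finite (fvs \<phi>)"
  by (induction \<phi>) (auto intro!: finite_vimageI simp: inj_def split: if_splits)

lemma tsubst_cong: "(\<And>\<sigma> i. (\<sigma>, i) \<in> tvs t \<Longrightarrow> \<theta> \<sigma> i = \<theta>' \<sigma> i) \<Longrightarrow> tsubst \<theta> t = tsubst \<theta>' t"
  by (induction t) auto

lemma subst_cong: "(\<And>\<sigma> i. (\<sigma>, i) \<in> fvs \<phi> \<Longrightarrow> \<theta> \<sigma> i = \<theta>' \<sigma> i) \<Longrightarrow> subst \<theta> \<phi> = subst \<theta>' \<phi>"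
proof (induction \<phi> arbitrary: \<theta> \<theta>')
  case (Forall \<tau> \<phi>)
  have "subst (under \<tau> \<theta>) \<phi> = subst (under \<tau> \<theta>') \<phi>"
    using Forall.prems
    by (intro Forall.IH) (auto simp: under_def scons_def split: nat.splits)
  then show ?case by simp
next
  case (Imp \<phi> \<psi>)
  from Imp.IH(1)[of \<theta> \<theta>'] Imp.IH(2)[of \<theta> \<theta>'] Imp.prems show ?case by simp
next
  case (Eq s t)
  then show ?case using tsubst_cong[of s \<theta> \<theta>'] tsubst_cong[of t \<theta> \<theta>'] by simp
next
  case (Less s t)
  then show ?case using tsubst_cong[of s \<theta> \<theta>'] tsubst_cong[of t \<theta> \<theta>'] by simp
qed simp

lemma subst_closed: "fvs \<phi> = {} \<Longrightarrow> subst \<theta> \<phi> = \<phi>"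
  using subst_cong[of \<phi> \<theta> Var] by simp

lemma fvs_Foralls: "fvs (foldr Forall bs \<phi>) = {(\<sigma>, i). (\<sigma>, i + count_list bs \<sigma>) \<in> fvs \<phi>}"
  by (induction bs) (auto simp: split: if_splits)

lemma ex_closure: "\<exists>bs. fvs (foldr Forall bs \<phi>) = {}"
proof -
  have "\<exists>bs. \<forall>(\<sigma>, i) \<in> F. i < count_list bs \<sigma>" if "finite F" for F
    using that
  proof induction
    case (insert p F)
    then obtain bs where bs: "\<forall>(\<sigma>, i) \<in> F. i < count_list bs \<sigma>" by auto
    obtain \<sigma> i where p: "p = (\<sigma>, i)" by force
    have c: "count_list (replicate n \<sigma>) \<tau> = (if \<tau> = \<sigma> then n else 0)" for n \<tau>
      by (induction n) auto
    \<comment> \<open>\<open>Suc i\<close> further binders of type \<open>\<sigma>\<close> capture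
      the new variable and never lower the counts that capture the old ones.\<close>
    show ?case
      by (rule exI[of _ "replicate (Suc i) \<sigma> @ bs"]) (use bs c in \<open>auto simp: p simp del: replicate_Suc\<close>)
  qed auto
  from this[OF finite_fvs[of \<phi>]] obtain bs where "\<forall>(\<sigma>, i) \<in> fvs \<phi>. i < count_list bs \<sigma>" by auto
  then have "fvs (foldr Forall bs \<phi>) = {}"
    by (force simp: fvs_Foralls)
  then show ?thesis by blast
qed


section \<open>Structural properties of derivations\<close>

lemma nd_mono: "nd T \<Gamma> \<phi> \<Longrightarrow> set \<Gamma> \<subseteq> set \<Gamma>' \<Longrightarrow> nd T \<Gamma>' \<phi>"
proof (induction arbitrary: \<Gamma>' rule: nd.induct)
  case (ImpI \<phi> \<Gamma> \<psi>)
  have "nd T (\<phi> # \<Gamma>') \<psi>" by (rule ImpI.IH) (use ImpI.prems in auto)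
  with ImpI.hyps(1) show ?case by (rule nd.ImpI)
next
  case (Raa \<phi> \<Gamma>)
  have "nd T (Neg \<phi> # \<Gamma>') Fls" by (rule Raa.IH) (use Raa.prems in auto)
  with Raa.hyps(1) show ?case by (rule nd.Raa)
next
  case (AllI \<tau> \<Gamma> \<phi>)
  have "nd T (map (lift \<tau>) \<Gamma>') \<phi>" by (rule AllI.IH) (use AllI.prems in auto)
  then show ?case by (rule nd.AllI)
next
  case (ImpE \<Gamma> \<phi> \<psi>)
  then show ?case using nd.ImpE by blast
next
  case (AllE \<Gamma> \<tau> \<phi> t)
  then show ?case by (intro nd.AllE) auto
next
  case (EqE \<phi> \<Gamma> s t)
  then show ?case using nd.EqE by blast
qed (auto intro: nd.Axm nd.Hyp nd.EqI)

text \<open>Axioms may be generalised over all their variables and then instantiated.\<close>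

lemma nd_subst_axiom:
  assumes "\<phi> \<in> T" "wts \<theta>"
  shows "nd T \<Gamma> (subst \<theta> \<phi>)"
proof -
  obtain bs where bs: "fvs (foldr Forall bs \<phi>) = {}" using ex_closure by blast
  have gen: "nd T \<Gamma> (foldr Forall bs \<phi>)" for \<Gamma>
    by (induction bs arbitrary: \<Gamma>) (auto intro: nd.Axm[OF assms(1)] nd.AllI)
  have step: "\<forall>\<theta>. wts \<theta> \<longrightarrow> nd T \<Gamma> (subst \<theta> \<chi>)"
    if "\<forall>\<theta>. wts \<theta> \<longrightarrow> nd T \<Gamma> (subst \<theta> (Forall \<tau> \<chi>))" for \<tau> \<chi>
  proof (intro allI impI)
    fix \<theta> assume \<theta>: "wts \<theta>"
    \<comment> \<open>\<open>\<theta>'\<close> forgets the value of \<open>\<theta>\<close> at the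
      outermost variable of type \<open>\<tau>\<close>. The instantiation by \<open>AllE\<close>
      puts this value back.\<close>
    define \<theta>' where "\<theta>' = (\<lambda>\<sigma> i. \<theta> \<sigma> (if \<sigma> = \<tau> then Suc i else i))"
    have "wts \<theta>'" using \<theta> by (simp add: wts_def \<theta>'_def)
    moreover have "scons (\<tau>, \<theta> \<tau> 0) \<theta>' = \<theta>"
      by (auto simp: scons_def \<theta>'_def fun_eq_iff split: nat.splits)
    moreover have "ty (\<theta> \<tau> 0) = Some \<tau>" using \<theta> by (simp add: wts_def)
    ultimately show "nd T \<Gamma> (subst \<theta> \<chi>)"
      using that nd.AllE[of T \<Gamma> \<tau> "subst (under \<tau> \<theta>') \<chi>" "\<theta> \<tau> 0"] by (auto simp: inst1_under)
  qed
  have "\<forall>\<theta>. wts \<theta> \<longrightarrow> nd T \<Gamma> (subst \<theta> \<phi>)"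
    if "\<forall>\<theta>. wts \<theta> \<longrightarrow> nd T \<Gamma> (subst \<theta> (foldr Forall bs \<phi>))" for bs
    using that by (induction bs) (simp, metis foldr_Cons comp_apply step)
  then show ?thesis
    using gen subst_closed[OF bs] assms(2) by metis
qed

text \<open>\<open>T\<close> need not be closed under substitution, so axioms go through their
  universal closure. In the quantifier rules the substitution passes under the binder and commutes
  with the shift of the context.\<close>

lemma nd_subst: "nd T \<Gamma> \<phi> \<Longrightarrow> wts \<theta> \<Longrightarrow> nd T (map (subst \<theta>) \<Gamma>) (subst \<theta> \<phi>)"
proof (induction arbitrary: \<theta> rule: nd.induct)
  case (Axm \<phi> \<Gamma>)
  then show ?case by (simp add: nd_subst_axiom)
next
  case (AllI \<tau> \<Gamma> \<phi>)
  from AllI.IH[of "under \<tau> \<theta>"] AllI.prems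
  have "nd T (map (lift \<tau>) (map (subst \<theta>) \<Gamma>)) (subst (under \<tau> \<theta>) \<phi>)"
    by (simp add: subst_lift comp_def)
  then show ?case by (simp add: nd.AllI)
next
  case (AllE \<Gamma> \<tau> \<phi> t)
  then show ?case by (simp add: subst_inst1 nd.AllE)
next
  case (EqE \<phi> \<Gamma> s t)
  have "nd T (map (subst \<theta>) \<Gamma>) (Eq (tsubst \<theta> s) (tsubst \<theta> t))"
    using EqE.IH(1) EqE.prems by simp
  moreover have "nd T (map (subst \<theta>) \<Gamma>) (inst [(N, tsubst \<theta> s)] [] (subst (under N \<theta>) \<phi>))"
    using EqE.IH(2)[of \<theta>] EqE.prems by (simp add: subst_inst1)
  ultimately show ?case
    using EqE.hyps(1) EqE.prems by (auto simp: subst_inst1 intro: nd.EqE)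
next
  case (ImpE \<Gamma> \<phi> \<psi>)
  from ImpE.IH[OF ImpE.prems] show ?case by (simp, elim nd.ImpE)
qed (auto intro: nd.Hyp nd.ImpI nd.Raa nd.EqI)

text \<open>The eigenvariable rule with a named fresh variable. A renaming moves \<open>k\<close> to
  the bound index 0 and shifts all other indices of type \<open>\<tau>\<close>: on
  \<open>\<Gamma>\<close> this is the lift, and on the instance it restores \<open>\<phi>\<close>.
  Under the binder the variable \<open>k\<close> appears as \<open>Suc k\<close>.\<close>

lemma nd_generalise:
  assumes nd: "nd T \<Gamma> (inst [(\<tau>, Var \<tau> k)] [] \<phi>)"
    and \<Gamma>: "\<And>\<gamma>. \<gamma> \<in> set \<Gamma> \<Longrightarrow> (\<tau>, k) \<notin> fvs \<gamma>" and \<phi>: "(\<tau>, Suc k) \<notin> fvs \<phi>"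
  shows "nd T \<Gamma> (Forall \<tau> \<phi>)"
proof -
  define \<theta> where "\<theta> = (\<lambda>\<sigma> i. if \<sigma> = \<tau> then Var \<tau> (if i = k then 0 else Suc i) else Var \<sigma> i)"
  have "wts \<theta>" by (simp add: wts_def \<theta>_def)
  from nd_subst[OF nd this] have "nd T (map (subst \<theta>) \<Gamma>) (subst \<theta> (inst [(\<tau>, Var \<tau> k)] [] \<phi>))" .
  moreover have "map (subst \<theta>) \<Gamma> = map (lift \<tau>) \<Gamma>"
    unfolding inst_def using \<Gamma> by (auto simp: \<theta>_def up_def intro!: subst_cong)
  moreover have "subst \<theta> (inst [(\<tau>, Var \<tau> k)] [] \<phi>) = subst Var \<phi>"
    unfolding inst_def subst_subst using \<phi>
    by (intro subst_cong) (auto simp: \<theta>_def scons_def split: nat.splits)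
  ultimately show ?thesis by (simp add: nd.AllI)
qed


section \<open>Henkin sets\<close>

instance ftype :: countable by countable_datatype
instance const :: countable by countable_datatype
instance trm :: countable by countable_datatype
instance fm :: countable by countable_datatype

lemma ex_fresh: "\<exists>k. (\<forall>\<gamma> \<in> set \<Gamma>. (\<tau>, k) \<notin> fvs \<gamma>) \<and> (\<tau>, Suc k) \<notin> fvs \<phi>"
proof -
  have "finite (snd ` (\<Union> (fvs ` set \<Gamma>) \<union> fvs \<phi>))" by auto
  then obtain k where k: "\<And>i. i \<in> snd ` (\<Union> (fvs ` set \<Gamma>) \<union> fvs \<phi>) \<Longrightarrow> i < k"
    by (meson finite_nat_set_iff_bounded)
  have "(\<tau>, k) \<notin> fvs \<gamma>" if "\<gamma> \<in> set \<Gamma>" for \<gamma>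
    using k[of k] that by (metis UN_I UnCI less_irrefl image_eqI snd_conv)
  moreover have "(\<tau>, Suc k) \<notin> fvs \<phi>"
    using k[of "Suc k"] by (metis Suc_n_not_le_n UnCI image_eqI less_imp_le snd_conv)
  ultimately show ?thesis by blast
qed

definition fresh :: "fm list \<Rightarrow> ftype \<Rightarrow> fm \<Rightarrow> nat" where
  "fresh \<Gamma> \<tau> \<phi> = (SOME k. (\<forall>\<gamma> \<in> set \<Gamma>. (\<tau>, k) \<notin> fvs \<gamma>) \<and> (\<tau>, Suc k) \<notin> fvs \<phi>)"

lemma fresh:
  "\<gamma> \<in> set \<Gamma> \<Longrightarrow> (\<tau>, fresh \<Gamma> \<tau> \<phi>) \<notin> fvs \<gamma>" "(\<tau>, Suc (fresh \<Gamma> \<tau> \<phi>)) \<notin> fvs \<phi>"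
  using someI_ex[OF ex_fresh[of \<Gamma> \<tau> \<phi>]] by (auto simp: fresh_def)

text \<open>Variables serve as Henkin constants: each stage is a finite list, so a fresh one is
  always available as a counterexample.\<close>

definition witness :: "fm list \<Rightarrow> fm \<Rightarrow> fm list" where
  "witness \<Gamma> \<chi> = (case \<chi> of
      Imp (Forall \<tau> \<phi>) Fls \<Rightarrow> [Neg (inst [(\<tau>, Var \<tau> (fresh (\<chi> # \<Gamma>) \<tau> \<phi>))] [] \<phi>)]
    | _ \<Rightarrow> [])"

definition extend :: "fm set \<Rightarrow> fm list \<Rightarrow> fm \<Rightarrow> fm list" where
  "extend T \<Gamma> \<chi> = (if wff \<chi> \<and> \<not> nd T (\<chi> # \<Gamma>) Fls then witness \<Gamma> \<chi> @ \<chi> # \<Gamma> else \<Gamma>)"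

text \<open>If a fresh counterexample to \<open>\<phi>\<close> led to a contradiction, then the
  instance of \<open>\<phi>\<close> at that variable, and by generalisation the universal formula,
  would be derivable, against the consistency of \<open>\<chi>\<close> with
  \<open>\<Gamma>\<close>.\<close>

lemma extend_consistent: "\<not> nd T \<Gamma> Fls \<Longrightarrow> \<not> nd T (extend T \<Gamma> \<chi>) Fls"
proof (cases "\<exists>\<tau> \<phi>. \<chi> = Neg (Forall \<tau> \<phi>) \<and> wff \<chi> \<and> \<not> nd T (\<chi> # \<Gamma>) Fls")
  case True
  then obtain \<tau> \<phi> where \<chi>: "\<chi> = Neg (Forall \<tau> \<phi>)" and w: "wff \<phi>" and c: "\<not> nd T (\<chi> # \<Gamma>) Fls" by auto
  let ?k = "fresh (\<chi> # \<Gamma>) \<tau> \<phi>"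
  let ?\<psi> = "inst [(\<tau>, Var \<tau> ?k)] [] \<phi>"
  show ?thesis
  proof
    assume "nd T (extend T \<Gamma> \<chi>) Fls"
    moreover have "extend T \<Gamma> \<chi> = Neg ?\<psi> # \<chi> # \<Gamma>"
      using c w by (simp add: extend_def witness_def \<chi>)
    ultimately have "nd T (Neg ?\<psi> # \<chi> # \<Gamma>) Fls" by simp
    with w have "nd T (\<chi> # \<Gamma>) ?\<psi>" by (intro nd.Raa[of ?\<psi>]) auto
    then have "nd T (\<chi> # \<Gamma>) (Forall \<tau> \<phi>)"
      by (rule nd_generalise) (fact fresh)+
    moreover have "nd T (\<chi> # \<Gamma>) (Neg (Forall \<tau> \<phi>))" by (rule nd.Hyp) (simp add: \<chi>)
    ultimately show False using c nd.ImpE[of T "\<chi> # \<Gamma>" "Forall \<tau> \<phi>" Fls] by blast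
  qed
next
  case False
  then have "wff \<chi> \<and> \<not> nd T (\<chi> # \<Gamma>) Fls \<Longrightarrow> witness \<Gamma> \<chi> = []"
    by (cases "\<exists>\<tau> \<phi>. \<chi> = Neg (Forall \<tau> \<phi>)") (auto simp: witness_def split: fm.split)
  moreover assume "\<not> nd T \<Gamma> Fls"
  ultimately show ?thesis by (auto simp: extend_def)
qed

text \<open>A maximal consistent theory. The assumption \<open>all_in\<close> is the Henkin property
  in contrapositive form: a false universal formula has a term as counterexample.\<close>

locale henkin =
  fixes T \<Delta> :: "fm set"
  assumes nd_in: "\<lbrakk>set \<Gamma> \<subseteq> \<Delta>; nd T \<Gamma> \<phi>; wff \<phi>\<rbrakk> \<Longrightarrow> \<phi> \<in> \<Delta>"
    and Fls_notin: "Fls \<notin> \<Delta>"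
    and complete: "wff \<phi> \<Longrightarrow> \<phi> \<in> \<Delta> \<or> Neg \<phi> \<in> \<Delta>"
    and all_in: "\<lbrakk>wff \<phi>; \<And>t. ty t = Some \<tau> \<Longrightarrow> inst [(\<tau>, t)] [] \<phi> \<in> \<Delta>\<rbrakk> \<Longrightarrow> Forall \<tau> \<phi> \<in> \<Delta>"
    and RCA: "RCA0w \<subseteq> T"

lemma henkin_exists:
  assumes RCA: "RCA0w \<subseteq> T" and w: "wff \<phi>" and not: "\<not> nd T [] \<phi>"
  obtains \<Delta> where "henkin T \<Delta>" "Neg \<phi> \<in> \<Delta>"
proof -
  \<comment> \<open>The Lindenbaum chain starts from the negation of \<open>\<phi>\<close> and
    visits every formula through \<open>from_nat\<close>.\<close>
  define G where "G = rec_nat [Neg \<phi>] (\<lambda>n \<Gamma>. extend T \<Gamma> (from_nat n))"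
  have G0: "G 0 = [Neg \<phi>]" and GS: "G (Suc n) = extend T (G n) (from_nat n)" for n
    by (auto simp: G_def)
  have cons: "\<not> nd T (G n) Fls" for n
  proof (induction n)
    case 0
    show ?case using not w nd.Raa[of \<phi> T "[]"] by (auto simp: G0)
  next
    case (Suc n)
    then show ?case by (simp add: GS extend_consistent)
  qed
  have mono: "set (G m) \<subseteq> set (G n)" if "m \<le> n" for m n
    using that by (rule lift_Suc_mono_le[rotated]) (auto simp: GS extend_def)
  \<comment> \<open>Membership means derivability from some stage, so that closure under derivations
    follows from \<open>cut\<close> and from the fact that finitely many members share a
    stage.\<close>
  define \<Delta> where "\<Delta> = {\<psi>. wff \<psi> \<and> (\<exists>n. nd T (G n) \<psi>)}"
  have cut: "nd T \<Gamma> \<psi> \<Longrightarrow> (\<And>\<gamma>. \<gamma> \<in> set \<Gamma> \<Longrightarrow> wff \<gamma> \<and> nd T \<Gamma>' \<gamma>) \<Longrightarrow> nd T \<Gamma>' \<psi>" for \<Gamma> \<Gamma>' \<psi>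
  proof (induction \<Gamma> arbitrary: \<psi>)
    case Nil
    then show ?case using nd_mono by fastforce
  next
    case (Cons \<gamma> \<Gamma>)
    have "nd T \<Gamma> (Imp \<gamma> \<psi>)" using Cons.prems by (intro nd.ImpI) auto
    then have "nd T \<Gamma>' (Imp \<gamma> \<psi>)" using Cons by auto
    then show ?case by (rule nd.ImpE) (use Cons.prems in auto)
  qed
  have fin: "\<exists>n. \<forall>\<gamma> \<in> set \<Gamma>. nd T (G n) \<gamma>" if "set \<Gamma> \<subseteq> \<Delta>" for \<Gamma>
    using that
  proof (induction \<Gamma>)
    case (Cons \<gamma> \<Gamma>)
    then obtain n m where "\<forall>\<gamma> \<in> set \<Gamma>. nd T (G n) \<gamma>" "nd T (G m) \<gamma>" by (auto simp: \<Delta>_def)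
    then have "\<forall>\<gamma> \<in> set (\<gamma> # \<Gamma>). nd T (G (max n m)) \<gamma>"
      using mono[of n "max n m"] mono[of m "max n m"] by (auto intro: nd_mono)
    then show ?case by blast
  qed auto
  have nd_in: "\<psi> \<in> \<Delta>" if "set \<Gamma> \<subseteq> \<Delta>" "nd T \<Gamma> \<psi>" "wff \<psi>" for \<Gamma> \<psi>
  proof -
    from fin[OF that(1)] obtain n where "\<forall>\<gamma> \<in> set \<Gamma>. nd T (G n) \<gamma>" by blast
    then have "nd T (G n) \<psi>" using cut[OF that(2)] that(1) by (auto simp: \<Delta>_def)
    then show ?thesis using that by (auto simp: \<Delta>_def)
  qed
  have Fls: "Fls \<notin> \<Delta>" using cons by (auto simp: \<Delta>_def)
  \<comment> \<open>The stage \<open>to_nat \<psi>\<close> treats \<open>\<psi>\<close> itself: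
    there it is added unless it is already refutable.\<close>
  have decide: "\<psi> \<in> set (G (Suc (to_nat \<psi>))) \<or> nd T (\<psi> # G (to_nat \<psi>)) Fls" if "wff \<psi>" for \<psi>
    using that by (auto simp: GS extend_def)
  have complete: "\<psi> \<in> \<Delta> \<or> Neg \<psi> \<in> \<Delta>" if "wff \<psi>" for \<psi>
    using decide[OF that] that by (auto simp: \<Delta>_def intro: nd.Hyp nd.ImpI)
  have all_in: "Forall \<tau> \<psi> \<in> \<Delta>"
    if \<psi>: "wff \<psi>" and *: "\<And>t. ty t = Some \<tau> \<Longrightarrow> inst [(\<tau>, t)] [] \<psi> \<in> \<Delta>" for \<tau> \<psi>
  \<comment> \<open>If the negated universal formula is refutable at its own stage, then
    \<open>Raa\<close> yields the universal formula. Otherwise that stage added a counterexample,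
    which clashes with the instance at the fresh variable.\<close>
  proof (cases "nd T (Neg (Forall \<tau> \<psi>) # G (to_nat (Neg (Forall \<tau> \<psi>)))) Fls")
    case True
    then have "nd T (G (to_nat (Neg (Forall \<tau> \<psi>)))) (Forall \<tau> \<psi>)"
      using \<psi> by (intro nd.Raa[of "Forall \<tau> \<psi>"]) auto
    then show ?thesis using \<psi> by (auto simp: \<Delta>_def)
  next
    case False
    let ?n = "to_nat (Neg (Forall \<tau> \<psi>))"
    let ?\<chi> = "inst [(\<tau>, Var \<tau> (fresh (Neg (Forall \<tau> \<psi>) # G ?n) \<tau> \<psi>))] [] \<psi>"
    have "Neg ?\<chi> \<in> set (G (Suc ?n))"
      using False \<psi> by (simp add: GS extend_def witness_def)
    then have "Neg ?\<chi> \<in> \<Delta>" using \<psi> by (auto simp: \<Delta>_def intro: nd.Hyp)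
    moreover have "?\<chi> \<in> \<Delta>" by (rule *) simp
    moreover have "nd T [Neg ?\<chi>, ?\<chi>] Fls"
      by (rule nd.ImpE[of _ _ ?\<chi>]) (simp_all add: nd.Hyp)
    ultimately have "Fls \<in> \<Delta>"
      using nd_in[of "[Neg ?\<chi>, ?\<chi>]" Fls] by simp
    with Fls show ?thesis by blast
  qed
  have "henkin T \<Delta>"
    by unfold_locales (use nd_in Fls complete all_in RCA in auto)
  moreover have "Neg \<phi> \<in> \<Delta>"
    using w by (auto simp: \<Delta>_def intro!: exI[of _ 0] nd.Hyp simp: G0)
  ultimately show ?thesis using that by blast
qed


section \<open>Semantics\<close>

type_synonym 'a env = "ftype \<Rightarrow> nat \<Rightarrow> 'a"

definition econs :: "ftype \<Rightarrow> 'a \<Rightarrow> 'a env \<Rightarrow> 'a env" where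
  "econs \<tau> x e = (\<lambda>\<sigma> i. if \<sigma> = \<tau> then (case i of 0 \<Rightarrow> x | Suc j \<Rightarrow> e \<sigma> j) else e \<sigma> i)"

text \<open>Every type is interpreted by the whole carrier \<open>'a\<close>; only the application depends on the
  type.  Equality at type \<open>N\<close> is the equality of \<open>'a\<close>.\<close>

locale struct =
  fixes ap :: "ftype \<Rightarrow> ftype \<Rightarrow> 'a \<Rightarrow> 'a \<Rightarrow> 'a" and con :: "const \<Rightarrow> 'a"
    and less :: "'a \<Rightarrow> 'a \<Rightarrow> bool" (infix "\<prec>" 50)
begin

primrec tval :: "'a env \<Rightarrow> trm \<Rightarrow> 'a" where
  "tval e (Var \<tau> i) = e \<tau> i"
| "tval e (Con c) = con c"
| "tval e (t \<cdot> u) = (case ty t of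
       Some (\<sigma> \<rightarrow> \<tau>) \<Rightarrow> ap \<sigma> \<tau> (tval e t) (tval e u) | _ \<Rightarrow> undefined)"

primrec sat :: "'a env \<Rightarrow> fm \<Rightarrow> bool" where
  "sat e (Eq s t) \<longleftrightarrow> tval e s = tval e t"
| "sat e (Less s t) \<longleftrightarrow> tval e s \<prec> tval e t"
| "sat e Fls \<longleftrightarrow> False"
| "sat e (Imp \<phi> \<psi>) \<longleftrightarrow> (sat e \<phi> \<longrightarrow> sat e \<psi>)"
| "sat e (Forall \<tau> \<phi>) \<longleftrightarrow> (\<forall>x. sat (econs \<tau> x e) \<phi>)"

lemma tval_tsubst: "wts \<theta> \<Longrightarrow> tval e (tsubst \<theta> t) = tval (\<lambda>\<sigma> i. tval e (\<theta> \<sigma> i)) t"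
  by (induction t) (auto split: option.split ftype.split)

lemma tval_econs_up: "tval (econs \<tau> x e) (tsubst (up [\<tau>]) t) = tval e t"
  unfolding tval_tsubst[OF wts_up]
  by (rule arg_cong2[where f = tval]) (auto simp: up_def econs_def fun_eq_iff)

lemma env_under:
  "(\<lambda>\<sigma> i. tval (econs \<tau> x e) (under \<tau> \<theta> \<sigma> i)) = econs \<tau> x (\<lambda>\<sigma> i. tval e (\<theta> \<sigma> i))"
proof -
  have "econs \<tau> x e \<tau> 0 = x" by (simp add: econs_def)
  then show ?thesis
    using tval_econs_up[of \<tau> x e]
    by (auto simp: under_def scons_def econs_def[of _ _ "\<lambda>\<sigma> i. tval e (\<theta> \<sigma> i)"] fun_eq_iff
        split: nat.splits)
qed

lemma sat_subst: "wts \<theta> \<Longrightarrow> sat e (subst \<theta> \<phi>) = sat (\<lambda>\<sigma> i. tval e (\<theta> \<sigma> i)) \<phi>"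
  by (induction \<phi> arbitrary: e \<theta>) (auto simp: tval_tsubst env_under)

definition extensional :: bool where
  "extensional \<longleftrightarrow> (\<forall>\<sigma> \<tau> f g. (\<forall>x. ap \<sigma> \<tau> f x = ap \<sigma> \<tau> g x) \<longrightarrow> f = g)"

definition models :: "fm set \<Rightarrow> bool" where
  "models T \<longleftrightarrow> extensional \<and> (\<forall>\<phi> \<in> T. wff \<phi> \<longrightarrow> (\<forall>e. sat e \<phi>))"

end


section \<open>The term model\<close>

lemma wff_Eqt: "ty s = Some \<tau> \<Longrightarrow> ty t = Some \<tau> \<Longrightarrow> wff (Eqt \<tau> s t)"
  by (induction \<tau> arbitrary: s t) auto

lemma subst_Eqt: "subst \<theta> (Eqt \<tau> s t) = Eqt \<tau> (tsubst \<theta> s) (tsubst \<theta> t)"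
proof (induction \<tau> arbitrary: \<theta> s t)
  case (Arr \<sigma> \<tau>)
  have "under \<sigma> \<theta> \<sigma> 0 = Var \<sigma> 0" by (simp add: under_def scons_def)
  then show ?case by (simp add: Arr under_up)
qed simp

declare Eqt.simps(2) [simp del]

context henkin
begin

lemma ax: "\<phi> \<in> RCA0w \<Longrightarrow> wff \<phi> \<Longrightarrow> \<phi> \<in> \<Delta>"
  using RCA nd_in[of "[]" \<phi>] by (auto intro: nd.Axm)

lemma mp: "Imp \<phi> \<psi> \<in> \<Delta> \<Longrightarrow> \<phi> \<in> \<Delta> \<Longrightarrow> wff \<psi> \<Longrightarrow> \<psi> \<in> \<Delta>"
  using nd_in[of "[Imp \<phi> \<psi>, \<phi>]" \<psi>] nd.ImpE[of T "[Imp \<phi> \<psi>, \<phi>]" \<phi> \<psi>] by (simp add: nd.Hyp)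

lemma Imp_iff: "wff \<phi> \<Longrightarrow> wff \<psi> \<Longrightarrow> Imp \<phi> \<psi> \<in> \<Delta> \<longleftrightarrow> (\<phi> \<in> \<Delta> \<longrightarrow> \<psi> \<in> \<Delta>)"
proof (intro iffI impI)
  assume w: "wff \<phi>" "wff \<psi>" and *: "\<phi> \<in> \<Delta> \<longrightarrow> \<psi> \<in> \<Delta>"
  show "Imp \<phi> \<psi> \<in> \<Delta>"
  proof (cases "\<phi> \<in> \<Delta>")
    case True
    with * w show ?thesis
      using nd_in[of "[\<psi>]" "Imp \<phi> \<psi>"] by (simp add: nd.ImpI nd.Hyp)
  next
    case False
    with complete w have n: "Neg \<phi> \<in> \<Delta>" by blast
    let ?\<Gamma> = "[Neg \<psi>, \<phi>, Neg \<phi>]"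
    have "nd T ?\<Gamma> Fls" by (rule nd.ImpE[of _ _ \<phi>]) (simp_all add: nd.Hyp)
    with w have "nd T [\<phi>, Neg \<phi>] \<psi>" by (intro nd.Raa[of \<psi>])
    with w n show ?thesis
      using nd_in[of "[Neg \<phi>]" "Imp \<phi> \<psi>"] by (simp add: nd.ImpI)
  qed
qed (use mp in blast)

lemma Forall_iff:
  "wff \<phi> \<Longrightarrow> Forall \<tau> \<phi> \<in> \<Delta> \<longleftrightarrow> (\<forall>t. ty t = Some \<tau> \<longrightarrow> inst [(\<tau>, t)] [] \<phi> \<in> \<Delta>)"
proof (intro iffI allI impI)
  fix t assume w: "wff \<phi>" and *: "Forall \<tau> \<phi> \<in> \<Delta>" and t: "ty t = Some \<tau>"
  have "nd T [Forall \<tau> \<phi>] (inst [(\<tau>, t)] [] \<phi>)"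
    by (rule nd.AllE) (use t in \<open>simp_all add: nd.Hyp\<close>)
  with * w t show "inst [(\<tau>, t)] [] \<phi> \<in> \<Delta>"
    using nd_in[of "[Forall \<tau> \<phi>]"] by simp
qed (use all_in in blast)

lemma Eqt_Arr_iff:
  assumes "ty s = Some (\<sigma> \<rightarrow> \<tau>)" "ty t = Some (\<sigma> \<rightarrow> \<tau>)"
  shows "Eqt (\<sigma> \<rightarrow> \<tau>) s t \<in> \<Delta> \<longleftrightarrow> (\<forall>u. ty u = Some \<sigma> \<longrightarrow> Eqt \<tau> (s \<cdot> u) (t \<cdot> u) \<in> \<Delta>)"
proof -
  have u: "scons (\<sigma>, u) Var \<sigma> 0 = u" for u by (simp add: scons_def)
  show ?thesis
    using assms by (simp add: Forall_iff wff_Eqt Eqt.simps(2)) (simp add: inst_def subst_Eqt tsubst_scons_up u)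
qed

section \<open>Equality inside a Henkin set\<close>

lemma Eq_subst:
  assumes "Eq s t \<in> \<Delta>" "inst [(N, s)] [] \<phi> \<in> \<Delta>" "wff \<phi>" "ty t = Some N"
  shows "inst [(N, t)] [] \<phi> \<in> \<Delta>"
proof -
  have "nd T [Eq s t, inst [(N, s)] [] \<phi>] (inst [(N, t)] [] \<phi>)"
    by (rule nd.EqE[of _ _ _ s]) (use assms in \<open>simp_all add: nd.Hyp\<close>)
  then show ?thesis by (rule nd_in[rotated]) (use assms in simp_all)
qed

text \<open>These are the contexts in which \<open>Eq_subst\<close> is used: the shift protects the
  fixed term while \<open>Var N 0\<close> is replaced.\<close>

lemma inst_Eq_up:
  "inst [(N, t)] [] (Eq (tsubst (up [N]) s) (Var N 0)) = Eq s t"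
  "inst [(N, t)] [] (Eq (Var N 0) (tsubst (up [N]) s)) = Eq t s"
  "inst [(N, t)] [] (Less (tsubst (up [N]) s) (Var N 0)) = Less s t"
  "inst [(N, t)] [] (Less (Var N 0) (tsubst (up [N]) s)) = Less t s"
proof -
  have "scons (N, t) Var N 0 = t" by (simp add: scons_def)
  then show "inst [(N, t)] [] (Eq (tsubst (up [N]) s) (Var N 0)) = Eq s t"
    "inst [(N, t)] [] (Eq (Var N 0) (tsubst (up [N]) s)) = Eq t s"
    "inst [(N, t)] [] (Less (tsubst (up [N]) s) (Var N 0)) = Less s t"
    "inst [(N, t)] [] (Less (Var N 0) (tsubst (up [N]) s)) = Less t s"
    by (simp_all add: inst_def tsubst_scons_up)
qed

lemma Eq_refl: "ty t = Some N \<Longrightarrow> Eq t t \<in> \<Delta>"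
  using nd_in[of "[]" "Eq t t"] by (simp add: nd.EqI)

lemma Eq_sym: "Eq s t \<in> \<Delta> \<Longrightarrow> ty s = Some N \<Longrightarrow> ty t = Some N \<Longrightarrow> Eq t s \<in> \<Delta>"
  using Eq_subst[of s t "Eq (Var N 0) (tsubst (up [N]) s)"] by (simp add: inst_Eq_up Eq_refl)

lemma Eq_trans:
  "Eq r s \<in> \<Delta> \<Longrightarrow> Eq s t \<in> \<Delta> \<Longrightarrow> ty r = Some N \<Longrightarrow> ty t = Some N \<Longrightarrow> Eq r t \<in> \<Delta>"
  using Eq_subst[of s t "Eq (tsubst (up [N]) r) (Var N 0)"] by (simp add: inst_Eq_up)

lemma Less_cong:
  assumes "Eq s s' \<in> \<Delta>" "Eq t t' \<in> \<Delta>" "Less s t \<in> \<Delta>"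
    "ty s = Some N" "ty s' = Some N" "ty t = Some N" "ty t' = Some N"
  shows "Less s' t' \<in> \<Delta>"
  using Eq_subst[of s s' "Less (Var N 0) (tsubst (up [N]) t)"]
    Eq_subst[of t t' "Less (tsubst (up [N]) s') (Var N 0)"] assms by (simp add: inst_Eq_up)

lemma Eqt_refl: "ty t = Some \<tau> \<Longrightarrow> Eqt \<tau> t t \<in> \<Delta>"
  by (induction \<tau> arbitrary: t) (simp_all add: Eq_refl Eqt_Arr_iff)

lemma Eqt_sym: "Eqt \<tau> s t \<in> \<Delta> \<Longrightarrow> ty s = Some \<tau> \<Longrightarrow> ty t = Some \<tau> \<Longrightarrow> Eqt \<tau> t s \<in> \<Delta>"
  by (induction \<tau> arbitrary: s t) (simp_all add: Eq_sym Eqt_Arr_iff)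

lemma Eqt_trans:
  "\<lbrakk>Eqt \<tau> r s \<in> \<Delta>; Eqt \<tau> s t \<in> \<Delta>; ty r = Some \<tau>; ty s = Some \<tau>; ty t = Some \<tau>\<rbrakk> \<Longrightarrow> Eqt \<tau> r t \<in> \<Delta>"
proof (induction \<tau> arbitrary: r s t)
  case N
  then show ?case using Eq_trans by simp
next
  case (Arr \<sigma> \<tau>)
  show ?case
    unfolding Eqt_Arr_iff[OF Arr.prems(3,5)]
  proof (intro allI impI)
    fix u assume u: "ty u = Some \<sigma>"
    have "Eqt \<tau> (r \<cdot> u) (s \<cdot> u) \<in> \<Delta>" "Eqt \<tau> (s \<cdot> u) (t \<cdot> u) \<in> \<Delta>"
      using Arr.prems u by (simp_all add: Eqt_Arr_iff)
    then show "Eqt \<tau> (r \<cdot> u) (t \<cdot> u) \<in> \<Delta>"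
      by (rule Arr.IH(2)) (use Arr.prems u in simp_all)
  qed
qed

text \<open>Pointwise equality handles the function, and the extensionality axiom handles the
  argument. This makes application well defined on equivalence classes.\<close>

lemma Eqt_cong:
  assumes "Eqt (\<sigma> \<rightarrow> \<tau>) f g \<in> \<Delta>" "Eqt \<sigma> x y \<in> \<Delta>"
    "ty f = Some (\<sigma> \<rightarrow> \<tau>)" "ty g = Some (\<sigma> \<rightarrow> \<tau>)" "ty x = Some \<sigma>" "ty y = Some \<sigma>"
  shows "Eqt \<tau> (f \<cdot> x) (g \<cdot> y) \<in> \<Delta>"
proof (rule Eqt_trans)
  show "Eqt \<tau> (f \<cdot> x) (g \<cdot> x) \<in> \<Delta>"
    using assms by (simp add: Eqt_Arr_iff)
  show "Eqt \<tau> (g \<cdot> x) (g \<cdot> y) \<in> \<Delta>"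
    using mp[OF ax[OF Extensionality]] assms by (simp add: wff_Eqt)
qed (use assms in simp_all)

section \<open>Classes of provably equal terms, numbered by the natural numbers\<close>

definition cl :: "ftype \<Rightarrow> trm \<Rightarrow> trm set" where
  "cl \<tau> t = {u. ty u = Some \<tau> \<and> Eqt \<tau> t u \<in> \<Delta>}"

lemma cl_eq_iff: "ty s = Some \<tau> \<Longrightarrow> ty t = Some \<tau> \<Longrightarrow> cl \<tau> s = cl \<tau> t \<longleftrightarrow> Eqt \<tau> s t \<in> \<Delta>"
  unfolding cl_def using Eqt_refl Eqt_sym Eqt_trans by blast

definition Cl :: "ftype \<Rightarrow> trm set set" where
  "Cl \<tau> = cl \<tau> ` {t. ty t = Some \<tau>}"

lemma ty_numeral: "ty ((Sc ^^ n) Zer) = Some N"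
  by (induction n) auto

lemma numerals_distinct: "i < j \<Longrightarrow> Eq ((Sc ^^ i) Zer) ((Sc ^^ j) Zer) \<notin> \<Delta>"
proof (induction i arbitrary: j)
  note t = ty_numeral
  case 0
  then obtain k where k: "j = Suc k" by (cases j) auto
  show ?case
  proof
    assume "Eq ((Sc ^^ 0) Zer) ((Sc ^^ j) Zer) \<in> \<Delta>"
    then have "Eq (Sc ((Sc ^^ k) Zer)) Zer \<in> \<Delta>" using t Eq_sym by (simp add: k)
    then show False
      using mp[OF ax[OF Suc_nonzero]] t[of k] Fls_notin by auto
  qed
next
  note t = ty_numeral
  case (Suc i)
  then obtain k where k: "j = Suc k" "i < k" by (cases j) auto
  show ?case
    using Suc.IH[OF k(2)] mp[OF ax[OF Suc_inject]] t by (auto simp: k)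
qed

text \<open>With infinitely many classes at every type, \<open>to_nat_on\<close> is onto, so that
  all types can share the carrier \<open>nat\<close>. At type \<open>N\<close> the numerals are
  pairwise distinct. At an arrow type, evaluation at a variable reaches every class of the target
  type.\<close>

lemma infinite_Cl: "infinite (Cl \<tau>)"
proof (induction \<tau>)
  case N
  note t = ty_numeral
  have "inj (\<lambda>n. cl N ((Sc ^^ n) Zer))"
    using numerals_distinct Eq_sym[OF _ t t]
    by (intro injI) (metis Eqt.simps(1) cl_eq_iff linorder_neqE_nat t)
  moreover have "range (\<lambda>n. cl N ((Sc ^^ n) Zer)) \<subseteq> Cl N" using t by (auto simp: Cl_def)
  ultimately show ?case using finite_imageD finite_subset infinite_UNIV_nat by blast
next
  case (Arr \<sigma> \<tau>)
  let ?h = "\<lambda>c. cl \<tau> ((SOME f. f \<in> c) \<cdot> Var \<sigma> 0)"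
  have "c \<in> ?h ` Cl (\<sigma> \<rightarrow> \<tau>)" if "c \<in> Cl \<tau>" for c
  proof -
    obtain t where t: "ty t = Some \<tau>" "c = cl \<tau> t" using \<open>c \<in> Cl \<tau>\<close> by (auto simp: Cl_def)
    \<comment> \<open>The constant function with value \<open>t\<close> evaluates to
      \<open>t\<close>. The class only offers some representative \<open>g\<close> of it, which is
      provably equal to \<open>?f\<close>.\<close>
    let ?f = "Con (CK \<tau> \<sigma>) \<cdot> t"
    have f: "ty ?f = Some (\<sigma> \<rightarrow> \<tau>)" using t by simp
    then have "?f \<in> cl (\<sigma> \<rightarrow> \<tau>) ?f" using Eqt_refl[OF f] by (simp add: cl_def)
    then have g: "(SOME f. f \<in> cl (\<sigma> \<rightarrow> \<tau>) ?f) \<in> cl (\<sigma> \<rightarrow> \<tau>) ?f" by (rule someI)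
    define g where "g = (SOME f. f \<in> cl (\<sigma> \<rightarrow> \<tau>) ?f)"
    from g have g: "ty g = Some (\<sigma> \<rightarrow> \<tau>)" "Eqt (\<sigma> \<rightarrow> \<tau>) ?f g \<in> \<Delta>"
      unfolding g_def[symmetric] by (auto simp: cl_def)
    have "Eqt \<tau> (?f \<cdot> Var \<sigma> 0) t \<in> \<Delta>"
      using t by (intro ax K_ax wff_Eqt) auto
    moreover have "Eqt \<tau> (?f \<cdot> Var \<sigma> 0) (g \<cdot> Var \<sigma> 0) \<in> \<Delta>"
      using g f by (intro Eqt_cong[of \<sigma>] Eqt_refl) auto
    ultimately have "cl \<tau> (g \<cdot> Var \<sigma> 0) = cl \<tau> t"
      using t g f by (simp flip: cl_eq_iff)
    then show ?thesis using t f unfolding g_def by (force simp: Cl_def)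
  qed
  then have "Cl \<tau> \<subseteq> ?h ` Cl (\<sigma> \<rightarrow> \<tau>)" by blast
  then show ?case using Arr.IH(2) finite_surj by blast
qed

definition val :: "ftype \<Rightarrow> trm \<Rightarrow> nat" where
  "val \<tau> t = to_nat_on (Cl \<tau>) (cl \<tau> t)"

definition rep :: "ftype \<Rightarrow> nat \<Rightarrow> trm" where
  "rep \<tau> n = (SOME t. ty t = Some \<tau> \<and> val \<tau> t = n)"

lemma countable_Cl: "countable (Cl \<tau>)"
  by (simp add: Cl_def)

lemma val_eq_iff: "ty s = Some \<tau> \<Longrightarrow> ty t = Some \<tau> \<Longrightarrow> val \<tau> s = val \<tau> t \<longleftrightarrow> Eqt \<tau> s t \<in> \<Delta>"
  unfolding val_def cl_eq_iff[symmetric]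
  using to_nat_on_inj[OF countable_Cl] by (simp add: Cl_def)

lemma ty_rep: "ty (rep \<tau> n) = Some \<tau>" and val_rep [simp]: "val \<tau> (rep \<tau> n) = n"
proof -
  have "n \<in> to_nat_on (Cl \<tau>) ` Cl \<tau>"
    using bij_betw_imp_surj_on[OF to_nat_on_infinite[OF countable_Cl infinite_Cl]] by simp
  then have "\<exists>t. ty t = Some \<tau> \<and> val \<tau> t = n" by (auto simp: Cl_def val_def)
  from someI_ex[OF this] show "ty (rep \<tau> n) = Some \<tau>" "val \<tau> (rep \<tau> n) = n"
    by (auto simp: rep_def)
qed

definition tm_ap :: "ftype \<Rightarrow> ftype \<Rightarrow> nat \<Rightarrow> nat \<Rightarrow> nat" where
  "tm_ap \<sigma> \<tau> m n = val \<tau> (rep (\<sigma> \<rightarrow> \<tau>) m \<cdot> rep \<sigma> n)"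

definition tm_con :: "const \<Rightarrow> nat" where
  "tm_con c = val (cty c) (Con c)"

definition tm_less :: "nat \<Rightarrow> nat \<Rightarrow> bool" where
  "tm_less m n \<longleftrightarrow> Less (rep N m) (rep N n) \<in> \<Delta>"

interpretation tm: struct tm_ap tm_con tm_less .

lemma Eqt_rep_val: "ty t = Some \<tau> \<Longrightarrow> Eqt \<tau> (rep \<tau> (val \<tau> t)) t \<in> \<Delta>"
  by (simp flip: val_eq_iff add: ty_rep)

text \<open>By \<open>Eqt_cong\<close> the outcome does not depend on the representatives chosen in
  \<open>tm_ap\<close>.\<close>

lemma tm_ap_val:
  assumes "ty f = Some (\<sigma> \<rightarrow> \<tau>)" "ty x = Some \<sigma>"
  shows "tm_ap \<sigma> \<tau> (val (\<sigma> \<rightarrow> \<tau>) f) (val \<sigma> x) = val \<tau> (f \<cdot> x)"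
  unfolding tm_ap_def using assms Eqt_cong[OF Eqt_rep_val Eqt_rep_val, of f \<sigma> \<tau> x]
  by (simp add: val_eq_iff ty_rep)

lemma tm_less_val:
  assumes "ty s = Some N" "ty t = Some N"
  shows "tm_less (val N s) (val N t) \<longleftrightarrow> Less s t \<in> \<Delta>"
proof -
  have "Eq (rep N (val N s)) s \<in> \<Delta>" "Eq (rep N (val N t)) t \<in> \<Delta>"
    using Eqt_rep_val[of _ N] assms by auto
  then show ?thesis
    unfolding tm_less_def using Less_cong Eq_sym ty_rep assms by metis
qed

text \<open>Every element is the number of a term, so agreement on all elements is agreement on all
  terms, which is the meaning of \<open>Eqt\<close> at arrow type in a Henkin set.\<close>

lemma tm_extensional: "tm.extensional"
  unfolding tm.extensional_def
proof (intro allI impI)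
  fix \<sigma> \<tau> f g assume *: "\<forall>x. tm_ap \<sigma> \<tau> f x = tm_ap \<sigma> \<tau> g x"
  have "Eqt (\<sigma> \<rightarrow> \<tau>) (rep (\<sigma> \<rightarrow> \<tau>) f) (rep (\<sigma> \<rightarrow> \<tau>) g) \<in> \<Delta>"
    unfolding Eqt_Arr_iff[OF ty_rep ty_rep]
  proof (intro allI impI)
    fix u assume u: "ty u = Some \<sigma>"
    have "val \<tau> (rep (\<sigma> \<rightarrow> \<tau>) f \<cdot> u) = val \<tau> (rep (\<sigma> \<rightarrow> \<tau>) g \<cdot> u)"
      using *[rule_format, of "val \<sigma> u"] tm_ap_val[OF ty_rep u, of \<tau> f] tm_ap_val[OF ty_rep u, of \<tau> g]
      by simp
    then show "Eqt \<tau> (rep (\<sigma> \<rightarrow> \<tau>) f \<cdot> u) (rep (\<sigma> \<rightarrow> \<tau>) g \<cdot> u) \<in> \<Delta>"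
      using u ty_rep by (simp flip: val_eq_iff)
  qed
  then show "f = g" by (simp flip: val_eq_iff add: ty_rep)
qed

lemma tval_tm: "wts \<theta> \<Longrightarrow> ty t = Some \<tau> \<Longrightarrow> tm.tval (\<lambda>\<sigma> i. val \<sigma> (\<theta> \<sigma> i)) t = val \<tau> (tsubst \<theta> t)"
proof (induction t arbitrary: \<tau>)
  case (App t u)
  then obtain \<sigma> where "ty t = Some (\<sigma> \<rightarrow> \<tau>)" "ty u = Some \<sigma>"
    by (auto split: option.splits ftype.splits if_splits)
  with App show ?case by (simp add: tm_ap_val)
qed (auto simp: tm_con_def)

text \<open>The truth lemma, for environments given by well-typed substitutions. In the quantifier
  case each element of the carrier is the value of a term of type \<open>\<tau>\<close>, so semantic
  quantification matches \<open>Forall_iff\<close>.\<close>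

lemma sat_tm: "wts \<theta> \<Longrightarrow> wff \<phi> \<Longrightarrow> tm.sat (\<lambda>\<sigma> i. val \<sigma> (\<theta> \<sigma> i)) \<phi> \<longleftrightarrow> subst \<theta> \<phi> \<in> \<Delta>"
proof (induction \<phi> arbitrary: \<theta>)
  case (Eq s t)
  then show ?case using val_eq_iff[of "tsubst \<theta> s" N "tsubst \<theta> t"] by (simp add: tval_tm)
next
  case (Less s t)
  then show ?case by (simp add: tval_tm tm_less_val)
next
  case Fls
  then show ?case using Fls_notin by simp
next
  case (Imp \<phi> \<psi>)
  then show ?case by (simp add: Imp_iff)
next
  case (Forall \<tau> \<phi>)
  have e: "econs \<tau> (val \<tau> t) (\<lambda>\<sigma> i. val \<sigma> (\<theta> \<sigma> i)) = (\<lambda>\<sigma> i. val \<sigma> (scons (\<tau>, t) \<theta> \<sigma> i))" for t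
    by (auto simp: econs_def scons_def fun_eq_iff split: nat.splits)
  have *: "tm.sat (econs \<tau> (val \<tau> t) (\<lambda>\<sigma> i. val \<sigma> (\<theta> \<sigma> i))) \<phi>
      \<longleftrightarrow> inst [(\<tau>, t)] [] (subst (under \<tau> \<theta>) \<phi>) \<in> \<Delta>" if "ty t = Some \<tau>" for t
    unfolding e inst1_under using Forall that by simp
  have "tm.sat (\<lambda>\<sigma> i. val \<sigma> (\<theta> \<sigma> i)) (Forall \<tau> \<phi>) \<longleftrightarrow>
      (\<forall>t. ty t = Some \<tau> \<longrightarrow> tm.sat (econs \<tau> (val \<tau> t) (\<lambda>\<sigma> i. val \<sigma> (\<theta> \<sigma> i))) \<phi>)"
    by (metis tm.sat.simps(5) ty_rep val_rep)
  then show ?case using * Forall.prems by (simp add: Forall_iff)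
qed

text \<open>An arbitrary environment comes from the substitution by representatives, and all
  substitution instances of axioms are derivable.\<close>

lemma tm_models: "tm.models T"
  unfolding tm.models_def
proof (intro conjI tm_extensional ballI impI allI)
  fix \<phi> e assume \<phi>: "\<phi> \<in> T" "wff \<phi>"
  define \<theta> :: sub where "\<theta> = (\<lambda>\<sigma> i. rep \<sigma> (e \<sigma> i))"
  have w: "wts \<theta>" by (simp add: wts_def \<theta>_def ty_rep)
  have "subst \<theta> \<phi> \<in> \<Delta>" using nd_in[of "[]"] nd_subst_axiom[OF \<phi>(1) w] \<phi> w by simp
  then have "tm.sat (\<lambda>\<sigma> i. val \<sigma> (\<theta> \<sigma> i)) \<phi>" using sat_tm w \<phi> by blast
  then show "tm.sat e \<phi>" by (simp add: \<theta>_def)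
qed

end

text \<open>A formula that is not derivable fails in the term model of a Henkin set containing its
  negation. Extensionality and the arithmetic in \<open>RCA0w\<close> are what make this model
  extensional with carrier \<open>nat\<close>.\<close>

theorem completeness:
  assumes RCA: "RCA0w \<subseteq> T" and w: "wff \<phi>"
    and valid: "\<And>(ap :: ftype \<Rightarrow> ftype \<Rightarrow> nat \<Rightarrow> nat \<Rightarrow> nat) con less e.
      struct.models ap con less T \<Longrightarrow> struct.sat ap con less e \<phi>"
  shows "T \<turnstile> \<phi>"
proof (rule ccontr)
  assume "\<not> T \<turnstile> \<phi>"
  with henkin_exists[OF RCA w] obtain \<Delta> where "henkin T \<Delta>" and n: "Neg \<phi> \<in> \<Delta>"
    by (auto simp: proves_def)
  then interpret henkin T \<Delta> by simp
  have "subst Var \<phi> \<in> \<Delta>"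
    using valid[OF tm_models] sat_tm[of Var \<phi>] w by (simp del: subst_Var)
  with n Fls_notin show False using mp[of \<phi> Fls] by simp
qed


section \<open>Models of the base theory\<close>

context struct
begin

text \<open>The semantic counterpart of \<open>up\<close>: the environment seen from outside the
  binders \<open>bs\<close>.\<close>

definition dropenv :: "ftype list \<Rightarrow> 'a env \<Rightarrow> 'a env" where
  "dropenv bs e = (\<lambda>\<sigma> i. e \<sigma> (i + count_list bs \<sigma>))"

lemma dropenv_simps [simp]: "dropenv [] e = e" "dropenv (\<tau> # bs) (econs \<tau> x e) = dropenv bs e"
  by (auto simp: dropenv_def econs_def fun_eq_iff)

lemma env_scons:
  "(\<lambda>\<sigma> i. tval e (scons (\<tau>, t) \<theta> \<sigma> i)) = econs \<tau> (tval e t) (\<lambda>\<sigma> i. tval e (\<theta> \<sigma> i))"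
  by (auto simp: scons_def econs_def fun_eq_iff split: nat.splits)

lemma sat_inst:
  assumes "list_all (\<lambda>(\<tau>, t). ty t = Some \<tau>) ps"
  shows "sat e (inst ps bs \<phi>)
    \<longleftrightarrow> sat (foldr (\<lambda>(\<tau>, t). econs \<tau> (tval e t)) ps (dropenv bs e)) \<phi>"
proof -
  have "wts (foldr scons ps (up bs))"
    using assms by (induction ps) auto
  moreover have "(\<lambda>\<sigma> i. tval e (foldr scons ps (up bs) \<sigma> i))
      = foldr (\<lambda>(\<tau>, t). econs \<tau> (tval e t)) ps (dropenv bs e)"
  proof (induction ps)
    case Nil
    show ?case by (simp add: up_def dropenv_def)
  next
    case (Cons p ps)
    obtain \<tau> t where "p = (\<tau>, t)" by force
    then show ?case by (simp add: env_scons Cons.IH)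
  qed
  ultimately show ?thesis by (simp add: inst_def sat_subst)
qed

end

lemma ty_lam [simp]: "ty t = Some \<tau> \<Longrightarrow> ty (lam \<rho> t) = Some (\<rho> \<rightarrow> \<tau>)"
  by (induction t arbitrary: \<tau>)
    (auto simp: Id_comb_def split: nat.splits option.splits ftype.splits if_splits)

lemma wff_inst:
  "list_all (\<lambda>(\<tau>, t). ty t = Some \<tau>) ps \<Longrightarrow> wff (inst ps bs \<phi>) = wff \<phi>"
proof -
  assume "list_all (\<lambda>(\<tau>, t). ty t = Some \<tau>) ps"
  then have "wts (foldr scons ps (up bs))" by (induction ps) auto
  then show ?thesis by (simp add: inst_def)
qed

named_theorems repr

locale aca_model = struct +
  assumes models: "models ACA0w"
begin

lemma ap_ext: "(\<And>x. ap \<sigma> \<tau> f x = ap \<sigma> \<tau> g x) \<Longrightarrow> f = g"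
  using models unfolding models_def extensional_def by blast

lemma rca: "\<phi> \<in> RCA0w \<Longrightarrow> wff \<phi> \<Longrightarrow> sat e \<phi>"
  using models by (auto simp: models_def ACA0w_def)

lemma sat_Eqt: "ty s = Some \<tau> \<Longrightarrow> ty t = Some \<tau> \<Longrightarrow> sat e (Eqt \<tau> s t) \<longleftrightarrow> tval e s = tval e t"
proof (induction \<tau> arbitrary: s t e)
  case (Arr \<sigma> \<tau>)
  have "econs \<sigma> x e \<sigma> 0 = x" for x by (simp add: econs_def)
  with Arr have "sat e (Eqt (\<sigma> \<rightarrow> \<tau>) s t) \<longleftrightarrow> (\<forall>x. ap \<sigma> \<tau> (tval e s) x = ap \<sigma> \<tau> (tval e t) x)"
    by (simp add: Eqt.simps(2) tval_econs_up)
  then show ?case using ap_ext by metis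
qed simp

text \<open>The axiom is taken at variables with distinct indices. An environment that looks at the
  index alone can then assign arbitrary objects, even if \<open>\<sigma>\<close> and
  \<open>\<tau>\<close> coincide. The axioms below are read off in the same way.\<close>

lemma ap_K [simp]: "ap \<tau> \<sigma> (ap \<sigma> (\<tau> \<rightarrow> \<sigma>) (con (CK \<sigma> \<tau>)) x) y = x"
  using rca[OF K_ax[of "Var \<sigma> 0" \<sigma> "Var \<tau> 1" \<tau>], of "\<lambda>_ i. if i = 0 then x else y"]
  by (simp add: sat_Eqt wff_Eqt)

lemma ap_S [simp]:
  "ap \<rho> \<tau> (ap (\<rho> \<rightarrow> \<sigma>) (\<rho> \<rightarrow> \<tau>) (ap (\<rho> \<rightarrow> \<sigma> \<rightarrow> \<tau>) ((\<rho> \<rightarrow> \<sigma>) \<rightarrow> \<rho> \<rightarrow> \<tau>) (con (CS \<rho> \<sigma> \<tau>)) f) g) x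
    = ap \<sigma> \<tau> (ap \<rho> (\<sigma> \<rightarrow> \<tau>) f x) (ap \<rho> \<sigma> g x)"
  using rca[OF S_ax[of "Var (\<rho> \<rightarrow> \<sigma> \<rightarrow> \<tau>) 0" \<rho> \<sigma> \<tau> "Var (\<rho> \<rightarrow> \<sigma>) 1" "Var \<rho> 2"],
      of "\<lambda>_ i. if i = 0 then f else if i = 1 then g else x"]
  by (simp add: sat_Eqt wff_Eqt)

abbreviation zero :: 'a where "zero \<equiv> con CZero"
abbreviation suc :: "'a \<Rightarrow> 'a" where "suc \<equiv> ap N N (con CSuc)"
abbreviation plus :: "'a \<Rightarrow> 'a \<Rightarrow> 'a" (infixl "\<oplus>" 65) where
  "x \<oplus> y \<equiv> ap N N (ap N T1 (con CPlus) x) y"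
abbreviation app1 :: "'a \<Rightarrow> 'a \<Rightarrow> 'a" (infixl "\<bullet>" 90) where "f \<bullet> n \<equiv> ap N N f n"
abbreviation rec :: "'a \<Rightarrow> 'a \<Rightarrow> 'a \<Rightarrow> 'a" where
  "rec f a n \<equiv> ap N N (ap N T1 (ap (N \<rightarrow> N \<rightarrow> N) (N \<rightarrow> N \<rightarrow> N) (con CRec) f) a) n"

lemma suc_nonzero [simp]: "suc x \<noteq> zero"
  using rca[OF Suc_nonzero[of "Var N 0"], of "\<lambda>_ _. x"] by simp

lemma suc_inject [simp]: "suc x = suc y \<longleftrightarrow> x = y"
  using rca[OF Suc_inject[of "Var N 0" "Var N 1"], of "\<lambda>_ i. if i = 0 then x else y"] by auto

lemma plus_zero [simp]: "x \<oplus> zero = x"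
  using rca[OF Plus_0[of "Var N 0"], of "\<lambda>_ _. x"] by simp

lemma plus_suc [simp]: "x \<oplus> suc y = suc (x \<oplus> y)"
  using rca[OF Plus_Suc[of "Var N 0" "Var N 1"], of "\<lambda>_ i. if i = 0 then x else y"] by simp

lemma not_less_zero [simp]: "\<not> x \<prec> zero"
  using rca[OF Less_0[of "Var N 0"], of "\<lambda>_ _. x"] by simp

lemma less_suc: "x \<prec> suc y \<longleftrightarrow> x \<prec> y \<or> x = y"
  using rca[OF Less_Suc[of "Var N 0" "Var N 1"], of "\<lambda>_ i. if i = 0 then x else y"] by auto

lemma rec_zero [simp]: "rec f a zero = a"
  using rca[OF Rec_0[of "Var (N \<rightarrow> N \<rightarrow> N) 0" "Var N 0"], of "\<lambda>\<sigma> i. if \<sigma> = N then a else f"] by simp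

lemma rec_suc [simp]: "rec f a (suc n) = ap N T1 f n \<bullet> rec f a n"
  using rca[OF Rec_Suc[of "Var (N \<rightarrow> N \<rightarrow> N) 0" "Var N 0" "Var N 1"],
      of "\<lambda>\<sigma> i. if \<sigma> = N then if i = 0 then a else n else f"] by simp

lemma qf_ind:
  assumes "f \<bullet> zero = zero" "\<And>n. f \<bullet> n = zero \<Longrightarrow> f \<bullet> suc n = zero"
  shows "f \<bullet> n = zero"
proof -
  let ?\<phi> = "Eq (Var T1 0 \<cdot> Var N 0) Zer"
  have "sat (\<lambda>_ _. f) (Imp (And (inst [(N, Zer)] [] ?\<phi>)
      (Forall N (Imp ?\<phi> (inst [(N, Sc (Var N 0))] [N] ?\<phi>)))) (Forall N ?\<phi>))"
    by (rule rca, rule QF_IND) (simp_all add: wff_inst)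
  then show ?thesis using assms by (simp add: sat_inst) (simp add: econs_def)
qed

lemma qf_choice:
  assumes "wff \<phi>" "qfree \<phi>" "\<And>f. \<exists>n. sat (econs N n (econs T1 f e)) \<phi>"
  obtains Y where "\<And>f. sat (econs N (ap T1 N Y f) (econs T1 f e)) \<phi>"
proof -
  have "sat e (Imp (Forall T1 (Exists N \<phi>))
           (Exists T2 (Forall T1 (inst [(N, Var T2 0 \<cdot> Var T1 0), (T1, Var T1 0)] [T1, T2] \<phi>))))"
    by (rule rca, rule QF_AC10) (use assms in \<open>simp_all add: wff_inst\<close>)
  with assms obtain Y where "\<forall>f. sat (econs T1 f (econs T2 Y e))
      (inst [(N, Var T2 0 \<cdot> Var T1 0), (T1, Var T1 0)] [T1, T2] \<phi>)" by auto
  moreover have "econs T1 f (econs T2 Y e) T2 0 = Y" "econs T1 f (econs T2 Y e) T1 0 = f" for f Y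
    by (simp_all add: econs_def)
  ultimately show ?thesis by (intro that[of Y]) (simp add: sat_inst)
qed


section \<open>Representable functions\<close>

text \<open>\<open>L \<sigma> \<tau> g\<close> is a junk value unless \<open>repf \<sigma> \<tau> g\<close>.  Used as rewrite rules, the facts in \<open>repr\<close>
  carry out bracket abstraction, so they show that a function built from internal ones by means of
  \<open>L\<close> and of arithmetical predicates is internal.\<close>

definition repf :: "ftype \<Rightarrow> ftype \<Rightarrow> ('a \<Rightarrow> 'a) \<Rightarrow> bool" where
  "repf \<sigma> \<tau> g \<longleftrightarrow> (\<exists>d. \<forall>x. ap \<sigma> \<tau> d x = g x)"

definition L :: "ftype \<Rightarrow> ftype \<Rightarrow> ('a \<Rightarrow> 'a) \<Rightarrow> 'a" where
  "L \<sigma> \<tau> g = (SOME d. \<forall>x. ap \<sigma> \<tau> d x = g x)"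

lemma repfI: "(\<And>x. ap \<sigma> \<tau> d x = g x) \<Longrightarrow> repf \<sigma> \<tau> g"
  by (auto simp: repf_def)

lemma L_beta: "repf \<sigma> \<tau> g \<Longrightarrow> ap \<sigma> \<tau> (L \<sigma> \<tau> g) x = g x"
  unfolding repf_def L_def using someI_ex[of "\<lambda>d. \<forall>x. ap \<sigma> \<tau> d x = g x"] by simp

lemma L_eqI:
  assumes "\<And>x. ap \<sigma> \<tau> d x = g x"
  shows "L \<sigma> \<tau> g = d"
proof (rule ap_ext)
  fix x
  have "repf \<sigma> \<tau> g" using assms by (rule repfI)
  then show "ap \<sigma> \<tau> (L \<sigma> \<tau> g) x = ap \<sigma> \<tau> d x" by (simp only: L_beta assms)
qed

abbreviation KK :: "ftype \<Rightarrow> ftype \<Rightarrow> 'a \<Rightarrow> 'a" where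
  "KK \<sigma> \<tau> c \<equiv> ap \<tau> (\<sigma> \<rightarrow> \<tau>) (con (CK \<tau> \<sigma>)) c"

abbreviation SS :: "ftype \<Rightarrow> ftype \<Rightarrow> ftype \<Rightarrow> 'a \<Rightarrow> 'a \<Rightarrow> 'a" where
  "SS \<rho> \<sigma> \<tau> f g \<equiv> ap (\<rho> \<rightarrow> \<sigma>) (\<rho> \<rightarrow> \<tau>)
     (ap (\<rho> \<rightarrow> \<sigma> \<rightarrow> \<tau>) ((\<rho> \<rightarrow> \<sigma>) \<rightarrow> \<rho> \<rightarrow> \<tau>) (con (CS \<rho> \<sigma> \<tau>)) f) g"

definition II :: "ftype \<Rightarrow> 'a" where
  "II \<sigma> = SS \<sigma> (\<sigma> \<rightarrow> \<sigma>) \<sigma> (con (CK \<sigma> (\<sigma> \<rightarrow> \<sigma>))) (con (CK \<sigma> \<sigma>))"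

lemma ap_II: "ap \<sigma> \<sigma> (II \<sigma>) x = x"
  by (simp add: II_def)

lemma repf_id [repr]: "repf \<sigma> \<sigma> (\<lambda>x. x)"
  by (rule repfI[of _ _ "II \<sigma>"]) (simp add: ap_II)

lemma L_id [repr]: "L \<sigma> \<sigma> (\<lambda>x. x) = II \<sigma>"
  by (rule L_eqI) (simp add: ap_II)

lemma repf_const [repr]: "repf \<sigma> \<tau> (\<lambda>x. c)"
  by (rule repfI[of _ _ "KK \<sigma> \<tau> c"]) simp

lemma L_const [repr]: "L \<sigma> \<tau> (\<lambda>x. c) = KK \<sigma> \<tau> c"
  by (rule L_eqI) simp

lemma repf_ap [repr]:
  assumes "repf \<rho> (\<sigma> \<rightarrow> \<tau>) h" "repf \<rho> \<sigma> k"
  shows "repf \<rho> \<tau> (\<lambda>x. ap \<sigma> \<tau> (h x) (k x))"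
  by (rule repfI[of _ _ "SS \<rho> \<sigma> \<tau> (L \<rho> (\<sigma> \<rightarrow> \<tau>) h) (L \<rho> \<sigma> k)"])
    (simp only: ap_S L_beta[OF assms(1)] L_beta[OF assms(2)])

lemma L_ap [repr]:
  assumes "repf \<rho> (\<sigma> \<rightarrow> \<tau>) h" "repf \<rho> \<sigma> k"
  shows "L \<rho> \<tau> (\<lambda>x. ap \<sigma> \<tau> (h x) (k x)) = SS \<rho> \<sigma> \<tau> (L \<rho> (\<sigma> \<rightarrow> \<tau>) h) (L \<rho> \<sigma> k)"
  by (rule L_eqI) (simp only: ap_S L_beta[OF assms(1)] L_beta[OF assms(2)])

text \<open>Zero codes truth, in accordance with the zero tests in
  \<open>(\<exists>\<^sup>2)\<close> and \<open>\<Sigma>-IND\<close>.\<close>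

definition chi :: "bool \<Rightarrow> 'a" where
  "chi P = (if P then zero else suc zero)"

lemma chi_eq_zero [simp]: "chi P = zero \<longleftrightarrow> P"
  by (simp add: chi_def)

lemma chi_TF [repr]: "chi True = zero" "chi False = suc zero"
  by (simp_all add: chi_def)

text \<open>\<open>QF-AC\<close> is applied to the graph of the characteristic function, which is
  quantifier-free along with \<open>A\<close>.\<close>

lemma qf_char:
  assumes "wff A" "qfree A" "\<And>n f e. sat (econs N n (econs T1 f e)) A \<longleftrightarrow> P f"
  shows "\<exists>Y. \<forall>f. ap T1 N Y f = chi (P f)"
proof -
  let ?\<phi> = "And (Imp A (Eq (Var N 0) Zer)) (Imp (Neg A) (Eq (Var N 0) (Sc Zer)))"
  have s: "sat (econs N n (econs T1 f e)) ?\<phi> \<longleftrightarrow> n = chi (P f)" for n f e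
    using assms(3) by (auto simp: chi_def econs_def)
  obtain Y where "sat (econs N (ap T1 N Y f) (econs T1 f (\<lambda>_ _. zero))) ?\<phi>" for f
    by (rule qf_choice[of ?\<phi> "\<lambda>_ _. zero"]) (use assms(1,2) s in auto)
  then show ?thesis using s by blast
qed

text \<open>\<open>QF-AC\<close> has a function argument, so two numbers are passed as the first two
  values of one function.\<close>

lemma qf_char2:
  assumes "\<exists>Y. \<forall>f. ap T1 N Y f = chi (P (f \<bullet> zero) (f \<bullet> suc zero))"
  shows "\<exists>d. \<forall>x y. ap N T1 d x \<bullet> y = chi (P x y)"
proof -
  obtain Y where Y: "\<And>f. ap T1 N Y f = chi (P (f \<bullet> zero) (f \<bullet> suc zero))"
    using assms by blast
  \<comment> \<open>The recursion takes the value \<open>x\<close> at zero and \<open>y\<close> at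
    every successor.\<close>
  define p where "p = (\<lambda>x y. L N N (\<lambda>n. rec (L N T1 (\<lambda>_. L N N (\<lambda>_. y))) x n))"
  have "ap N T1 (L N T1 (\<lambda>_. L N N (\<lambda>_. y))) m \<bullet> n = y" for m n y
    by (simp add: L_beta repr)
  then have p: "p x y \<bullet> zero = x" "p x y \<bullet> suc zero = y" for x y
    by (simp_all add: p_def L_beta repf_ap repf_const repf_id)
  let ?d = "L N T1 (\<lambda>x. L N N (\<lambda>y. ap T1 N Y (p x y)))"
  have "ap N T1 ?d x = L N N (\<lambda>y. ap T1 N Y (p x y))" for x
    unfolding p_def by (rule L_beta) (simp only: repr)
  moreover have "L N N (\<lambda>y. ap T1 N Y (p x y)) \<bullet> y = ap T1 N Y (p x y)" for x y
    unfolding p_def by (rule L_beta) (simp only: repr)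
  ultimately have "ap N T1 ?d x \<bullet> y = chi (P x y)" for x y
    by (simp add: Y p)
  then show ?thesis by blast
qed

lemma ex_EQ: "\<exists>d. \<forall>x y. ap N T1 d x \<bullet> y = chi (x = y)"
  by (rule qf_char2, rule qf_char[where A = "Eq (Var T1 0 \<cdot> Zer) (Var T1 0 \<cdot> Sc Zer)"])
    (simp_all add: econs_def)

lemma ex_LESS: "\<exists>d. \<forall>x y. ap N T1 d x \<bullet> y = chi (x \<prec> y)"
  by (rule qf_char2, rule qf_char[where A = "Less (Var T1 0 \<cdot> Zer) (Var T1 0 \<cdot> Sc Zer)"])
    (simp_all add: econs_def)

lemma ex_IMP: "\<exists>d. \<forall>x y. ap N T1 d x \<bullet> y = chi (x = zero \<longrightarrow> y = zero)"
  by (rule qf_char2, rule qf_char[where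
        A = "Imp (Eq (Var T1 0 \<cdot> Zer) Zer) (Eq (Var T1 0 \<cdot> Sc Zer) Zer)"])
    (simp_all add: econs_def)

lemma ex_EE: "\<exists>d. \<forall>f. ap T1 N d f = chi (\<exists>n. f \<bullet> n = zero)"
proof -
  have "sat (\<lambda>_ _. zero) Ex2"
    using models by (auto simp: models_def ACA0w_def Ex2_def)
  then show ?thesis
    by (simp add: Ex2_def econs_def chi_def) metis
qed

definition "EQ = (SOME d. \<forall>x y. ap N T1 d x \<bullet> y = chi (x = y))"
definition "LESS = (SOME d. \<forall>x y. ap N T1 d x \<bullet> y = chi (x \<prec> y))"
definition "IMP = (SOME d. \<forall>x y. ap N T1 d x \<bullet> y = chi (x = zero \<longrightarrow> y = zero))"
definition "EE = (SOME d. \<forall>f. ap T1 N d f = chi (\<exists>n. f \<bullet> n = zero))"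

lemma chi_eq [repr]: "chi (x = y) = ap N T1 EQ x \<bullet> y"
  using someI_ex[OF ex_EQ] by (simp add: EQ_def)

lemma chi_less [repr]: "chi (x \<prec> y) = ap N T1 LESS x \<bullet> y"
  using someI_ex[OF ex_LESS] by (simp add: LESS_def)

lemma chi_imp [repr]: "chi (P \<longrightarrow> Q) = ap N T1 IMP (chi P) \<bullet> chi Q"
  using someI_ex[OF ex_IMP] by (simp add: IMP_def)

lemma chi_not [repr]: "chi (\<not> P) = ap N T1 IMP (chi P) \<bullet> suc zero"
  using chi_imp[of P False] by (simp add: chi_TF)

lemma chi_or [repr]: "chi (P \<or> Q) = ap N T1 IMP (ap N T1 IMP (chi P) \<bullet> suc zero) \<bullet> chi Q"
  using chi_imp[of "\<not> P" Q] by (simp add: disj_imp chi_not)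

lemma chi_and [repr]:
  "chi (P \<and> Q) = ap N T1 IMP (ap N T1 IMP (chi P) \<bullet> (ap N T1 IMP (chi Q) \<bullet> suc zero)) \<bullet> suc zero"
  by (simp only: chi_not[symmetric] chi_imp[symmetric]) simp

lemma chi_ex [repr]:
  "repf N N (\<lambda>n. chi (P n)) \<Longrightarrow> chi (\<exists>n. P n) = ap T1 N EE (L N N (\<lambda>n. chi (P n)))"
  using someI_ex[OF ex_EE] by (simp add: EE_def L_beta)

lemma chi_all [repr]:
  assumes "repf N N (\<lambda>n. ap N T1 IMP (chi (P n)) \<bullet> suc zero)"
  shows "chi (\<forall>n. P n)
    = ap N T1 IMP (ap T1 N EE (L N N (\<lambda>n. ap N T1 IMP (chi (P n)) \<bullet> suc zero))) \<bullet> suc zero"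
  using chi_not[of "\<exists>n. \<not> P n"] chi_ex[of "\<lambda>n. \<not> P n"] assms by (simp add: chi_not)

text \<open>Quantifier-free induction for the characteristic function. Since \<open>EE\<close>
  absorbs number quantifiers, this gives induction for all predicates arithmetical in internal
  objects.\<close>

lemma ind:
  assumes "repf N N (\<lambda>n. chi (P n))" "P zero" "\<And>n. P n \<Longrightarrow> P (suc n)"
  shows "P n"
  using qf_ind[of "L N N (\<lambda>n. chi (P n))" n] assms by (simp add: L_beta)

text \<open>Feferman's operator. With the functional of \<open>(\<exists>\<^sup>2)\<close> as
  parameter, the implication from the existence of a zero of \<open>f\<close> to
  \<open>f(n) = 0\<close> is quantifier-free, so \<open>QF-AC\<close> chooses
  \<open>n\<close>.\<close>

lemma ex_MU: "\<exists>d. \<forall>f. (\<exists>n. f \<bullet> n = zero) \<longrightarrow> f \<bullet> ap T1 N d f = zero"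
proof -
  let ?\<phi> = "Imp (Eq (Var T2 0 \<cdot> Var T1 0) Zer) (Eq (Var T1 0 \<cdot> Var N 0) Zer)"
  have E: "ap T1 N EE f = chi (\<exists>n. f \<bullet> n = zero)" for f
    using someI_ex[OF ex_EE] by (simp add: EE_def)
  have s: "sat (econs N n (econs T1 f (\<lambda>_ _. EE))) ?\<phi> \<longleftrightarrow> ((\<exists>n. f \<bullet> n = zero) \<longrightarrow> f \<bullet> n = zero)" for n f
    by (simp add: econs_def E)
  obtain Y where "sat (econs N (ap T1 N Y f) (econs T1 f (\<lambda>_ _. EE))) ?\<phi>" for f
    by (rule qf_choice[of ?\<phi> "\<lambda>_ _. EE"]) (use s in auto)
  then show ?thesis using s by blast
qed

definition "MU = (SOME d. \<forall>f. (\<exists>n. f \<bullet> n = zero) \<longrightarrow> f \<bullet> ap T1 N d f = zero)"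

text \<open>The solution need not be the least one. Being a term of the model, it may stand below
  abstractions, which makes the choice uniform in parameters.\<close>

abbreviation pick :: "('a \<Rightarrow> bool) \<Rightarrow> 'a" where
  "pick P \<equiv> ap T1 N MU (L N N (\<lambda>n. chi (P n)))"

lemma pickI:
  assumes "repf N N (\<lambda>n. chi (P n))" "\<exists>n. P n"
  shows "P (pick P)"
proof -
  let ?f = "L N N (\<lambda>n. chi (P n))"
  have "?f \<bullet> n = chi (P n)" for n using assms(1) by (rule L_beta)
  moreover have "(\<exists>n. ?f \<bullet> n = zero) \<longrightarrow> ?f \<bullet> pick P = zero"
    using someI_ex[OF ex_MU] by (simp add: MU_def)
  ultimately show ?thesis using assms(2) by simp
qed


section \<open>Arithmetical formulas are representable\<close>

text \<open>Applicative polynomials in the variables of the environment, with elements of the model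
  as constants. Bracket abstraction works by induction on them.\<close>

inductive rep_env :: "ftype \<Rightarrow> ('a env \<Rightarrow> 'a) \<Rightarrow> bool" where
  rvar: "rep_env \<tau> (\<lambda>e. e \<tau> i)"
| rconst: "rep_env \<tau> (\<lambda>e. c)"
| rap: "rep_env (\<sigma> \<rightarrow> \<tau>) F \<Longrightarrow> rep_env \<sigma> G \<Longrightarrow> rep_env \<tau> (\<lambda>e. ap \<sigma> \<tau> (F e) (G e))"

text \<open>The two claims go together: rewriting the abstraction of an application by
  \<open>L_ap\<close> requires both parts to be representable.\<close>

lemma rep_env_L:
  assumes "rep_env \<tau> F"
  shows "repf \<sigma> \<tau> (\<lambda>x. F (econs \<sigma> x e)) \<and> rep_env (\<sigma> \<rightarrow> \<tau>) (\<lambda>e. L \<sigma> \<tau> (\<lambda>x. F (econs \<sigma> x e)))"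
  using assms
proof (induction arbitrary: e)
  case (rvar \<tau> i)
  consider "\<sigma> = \<tau>" "i = 0" | j where "\<sigma> = \<tau>" "i = Suc j" | "\<sigma> \<noteq> \<tau>" by (cases i) auto
  then show ?case
    by cases (auto simp: econs_def repr intro!: rep_env.intros)
next
  case (rconst \<tau> c)
  then show ?case by (simp add: repr rep_env.intros)
next
  case (rap \<rho> \<tau> F G)
  then show ?case by (auto simp add: repf_ap L_ap intro!: rep_env.intros)
qed

lemma rep_env_repf: "rep_env \<tau> F \<Longrightarrow> repf \<sigma> \<tau> (\<lambda>x. F (econs \<sigma> x e))"
  using rep_env_L by blast

lemma rep_env_abs: "rep_env \<tau> F \<Longrightarrow> rep_env (\<sigma> \<rightarrow> \<tau>) (\<lambda>e. L \<sigma> \<tau> (\<lambda>x. F (econs \<sigma> x e)))"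
  using rep_env_L by blast

lemma rep_env_tval: "ty t = Some \<tau> \<Longrightarrow> rep_env \<tau> (\<lambda>e. tval e t)"
  by (induction t arbitrary: \<tau>)
    (auto split: option.splits ftype.splits if_splits intro!: rep_env.intros)

text \<open>Atoms and connectives have internal characteristic functions, and \<open>EE\<close>
  applied to an abstraction decides a number quantifier.\<close>

lemma rep_env_sat: "wff \<phi> \<Longrightarrow> arithmetical \<phi> \<Longrightarrow> rep_env N (\<lambda>e. chi (sat e \<phi>))"
proof (induction \<phi>)
  case (Eq s t)
  then show ?case by (simp only: sat.simps repr) (intro rep_env.intros rep_env_tval; simp)
next
  case (Less s t)
  then show ?case by (simp only: sat.simps repr) (intro rep_env.intros rep_env_tval; simp)
next
  case Fls
  then show ?case by (simp add: repr rep_env.intros)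
next
  case (Imp \<phi> \<psi>)
  then show ?case by (simp only: sat.simps repr) (intro rep_env.intros; simp)
next
  case (Forall \<tau> \<phi>)
  then have r: "rep_env N (\<lambda>e. ap N T1 IMP (chi (sat e \<phi>)) \<bullet> suc zero)"
    by (intro rep_env.intros) simp_all
  from Forall.prems have "chi (sat e (Forall \<tau> \<phi>)) = ap N T1 IMP (ap T1 N EE
      (L N N (\<lambda>n. ap N T1 IMP (chi (sat (econs N n e) \<phi>)) \<bullet> suc zero))) \<bullet> suc zero" for e
    using rep_env_repf[OF r, of N e] by (simp only: sat.simps arithmetical.simps chi_all)
  then show ?case
    by (simp only:) (intro rep_env.intros rep_env_abs[OF r])
qed

lemma tval_lam: "ty t = Some \<tau> \<Longrightarrow> ap \<rho> \<tau> (tval e (lam \<rho> t)) x = tval (econs \<rho> x e) t"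
proof (induction t arbitrary: \<tau>)
  case (Var \<tau> i)
  then show ?case by (auto simp: econs_def Id_comb_def split: nat.splits)
next
  case (App t u)
  then obtain \<sigma> where "ty t = Some (\<sigma> \<rightarrow> \<tau>)" "ty u = Some \<sigma>"
    by (auto split: option.splits ftype.splits if_splits)
  with App show ?case by simp
qed auto

text \<open>All parameters are absorbed into one internal object, so an instance of a scheme becomes
  a statement about a single \<open>Y\<close>.\<close>

lemma repr_formula2:
  assumes "wff \<psi>" "arithmetical \<psi>"
  obtains Y where "\<And>c f. ap T1 N (ap N T2 Y c) f = chi (sat (econs T1 f (econs N c e)) \<psi>)"
proof -
  note r = rep_env_sat[OF assms]
  let ?Y = "L N T2 (\<lambda>c. L T1 N (\<lambda>f. chi (sat (econs T1 f (econs N c e)) \<psi>)))"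
  have "ap T1 N (ap N T2 ?Y c) f = chi (sat (econs T1 f (econs N c e)) \<psi>)" for c f
    using rep_env_repf[OF r] rep_env_repf[OF rep_env_abs[OF r]] by (simp add: L_beta)
  then show ?thesis using that by blast
qed

lemma repr_formula3:
  assumes "wff \<psi>" "arithmetical \<psi>"
  obtains Y where "\<And>n m f. ap T1 N (ap N T2 (ap N (N \<rightarrow> T2) Y n) m) f
    = chi (sat (econs T1 f (econs N m (econs N n e))) \<psi>)"
proof -
  note r = rep_env_sat[OF assms]
  let ?Y = "L N (N \<rightarrow> T2) (\<lambda>n. L N T2 (\<lambda>m. L T1 N (\<lambda>f.
    chi (sat (econs T1 f (econs N m (econs N n e))) \<psi>))))"
  have "ap T1 N (ap N T2 (ap N (N \<rightarrow> T2) ?Y n) m) f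
    = chi (sat (econs T1 f (econs N m (econs N n e))) \<psi>)" for n m f
    using rep_env_repf[OF r] rep_env_repf[OF rep_env_abs[OF r]]
      rep_env_repf[OF rep_env_abs[OF rep_env_abs[OF r]]] by (simp add: L_beta)
  then show ?thesis using that by blast
qed

end


section \<open>Arithmetic and sequence codes in the model\<close>

context struct
begin

lemma tval_cong: "(\<And>\<sigma> i. (\<sigma>, i) \<in> tvs t \<Longrightarrow> e \<sigma> i = e' \<sigma> i) \<Longrightarrow> tval e t = tval e' t"
proof (induction t)
  case (App t u)
  then have "tval e t = tval e' t" "tval e u = tval e' u" by simp_all
  then show ?case by (simp cong: option.case_cong ftype.case_cong)
qed simp_all

end

lemma ty_tri_trm [simp]: "ty tri_trm = Some T1"
  by (simp add: tri_trm_def del: lam.simps)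

lemma ty_snoc_trm [simp]: "ty snoc_trm = Some (N \<rightarrow> T1)"
  by (simp add: snoc_trm_def del: lam.simps)

lemma ty_seg_trm [simp]: "ty seg_trm = Some (T1 \<rightarrow> T1)"
  by (simp add: seg_trm_def snoc_def del: lam.simps)

lemma tvs_snoc_trm [simp]: "tvs snoc_trm = {}"
  by (simp add: snoc_trm_def tri_trm_def Id_comb_def)

lemma tvs_seg_trm [simp]: "tvs seg_trm = {}"
proof -
  \<comment> \<open>Only the type and the closedness of \<open>snoc_trm\<close> matter here: bracket
    abstraction preserves closedness of typed terms.\<close>
  obtain t where t: "ty t = Some (N \<rightarrow> T1)" "tvs t = {}" "snoc_trm = t"
    using ty_snoc_trm tvs_snoc_trm by blast
  have "tvs (lam \<rho> t) = {}" if "tvs t = {}" "ty t = Some \<tau>" for t \<rho> \<tau>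
    using that by (induction t arbitrary: \<tau>) (auto split: option.splits ftype.splits if_splits)
  with t show ?thesis
    by (auto simp: seg_trm_def snoc_def Id_comb_def)
qed

context aca_model
begin

section \<open>Addition and order\<close>

lemma zero_plus [simp]: "zero \<oplus> n = n"
  by (rule ind[where P = "\<lambda>n. zero \<oplus> n = n"]) (simp only: repr, simp_all)

lemma suc_plus [simp]: "suc m \<oplus> n = suc (m \<oplus> n)"
  by (rule ind[where P = "\<lambda>n. suc m \<oplus> n = suc (m \<oplus> n)"]) (simp only: repr, simp_all)

lemma plus_comm: "m \<oplus> n = n \<oplus> m"
  by (rule ind[where P = "\<lambda>n. m \<oplus> n = n \<oplus> m"]) (simp only: repr, simp_all)

lemma plus_assoc: "k \<oplus> m \<oplus> n = k \<oplus> (m \<oplus> n)"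
  by (rule ind[where P = "\<lambda>n. k \<oplus> m \<oplus> n = k \<oplus> (m \<oplus> n)"]) (simp only: repr, simp_all)

lemma plus_left_comm: "k \<oplus> (m \<oplus> n) = m \<oplus> (k \<oplus> n)"
  using plus_assoc plus_comm by metis

lemma plus_cancel_right [simp]: "m \<oplus> k = n \<oplus> k \<longleftrightarrow> m = n"
proof -
  have "m \<oplus> k = n \<oplus> k \<longrightarrow> m = n"
    by (rule ind[where P = "\<lambda>k. m \<oplus> k = n \<oplus> k \<longrightarrow> m = n"]) (simp only: repr, simp_all)
  then show ?thesis by auto
qed

lemma plus_cancel_left [simp]: "k \<oplus> m = k \<oplus> n \<longleftrightarrow> m = n"
  using plus_comm plus_cancel_right by metis

lemma less_trans: "x \<prec> y \<Longrightarrow> y \<prec> z \<Longrightarrow> x \<prec> z"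
proof -
  assume xy: "x \<prec> y"
  have "y \<prec> z \<longrightarrow> x \<prec> z"
    by (rule ind[where P = "\<lambda>z. y \<prec> z \<longrightarrow> x \<prec> z"]) (simp only: repr, use xy less_suc in auto)
  then show "y \<prec> z \<Longrightarrow> x \<prec> z" by blast
qed

lemma suc_less_sucD: "suc x \<prec> suc y \<Longrightarrow> x \<prec> y"
  using less_trans[of x "suc x" y] by (auto simp: less_suc)

lemma less_irrefl [simp]: "\<not> n \<prec> n"
  by (rule ind[where P = "\<lambda>n. \<not> n \<prec> n"]) (simp only: repr, use suc_less_sucD in auto)

lemma nat_cases: "n = zero \<or> (\<exists>m. n = suc m)"
  by (rule ind[where P = "\<lambda>n. n = zero \<or> (\<exists>m. n = suc m)"]) (simp only: repr, simp_all)

lemma less_iff: "x \<prec> y \<longleftrightarrow> (\<exists>d. y = x \<oplus> suc d)"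
proof
  have "x \<prec> y \<longrightarrow> (\<exists>d. y = x \<oplus> suc d)"
    by (rule ind[where P = "\<lambda>y. x \<prec> y \<longrightarrow> (\<exists>d. y = x \<oplus> suc d)"])
      (simp only: repr, simp, metis less_suc plus_suc plus_zero)
  then show "x \<prec> y \<Longrightarrow> \<exists>d. y = x \<oplus> suc d" by blast
next
  have "x \<prec> x \<oplus> suc d" for d
    by (rule ind[where P = "\<lambda>d. x \<prec> x \<oplus> suc d"]) (simp only: repr, simp_all add: less_suc)
  then show "\<exists>d. y = x \<oplus> suc d \<Longrightarrow> x \<prec> y" by blast
qed

lemma less_linear: "x \<prec> y \<or> x = y \<or> y \<prec> x"
proof (rule ind[where P = "\<lambda>x. x \<prec> y \<or> x = y \<or> y \<prec> x"])
  show "zero \<prec> y \<or> zero = y \<or> y \<prec> zero"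
    using nat_cases[of y] by (auto simp: less_iff)
next
  fix x assume *: "x \<prec> y \<or> x = y \<or> y \<prec> x"
  have "suc x \<prec> y \<or> suc x = y" if xy: "x \<prec> y"
  proof -
    obtain d where "y = x \<oplus> suc d" using xy by (auto simp: less_iff)
    then show ?thesis using nat_cases[of d] by (auto simp: less_iff)
  qed
  with * show "suc x \<prec> y \<or> suc x = y \<or> y \<prec> suc x" by (auto simp: less_suc)
qed (simp only: repr)

lemma plus_lessD: "a \<oplus> b \<prec> c \<Longrightarrow> a \<prec> c" "a \<oplus> b \<prec> c \<Longrightarrow> b \<prec> c"
  unfolding less_iff by (metis plus_assoc plus_suc, metis plus_assoc plus_comm plus_suc)

section \<open>Cantor pairing and codes of initial segments\<close>

definition TRI :: 'a where "TRI = tval (\<lambda>_ _. zero) tri_trm"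

abbreviation tri :: "'a \<Rightarrow> 'a" where "tri n \<equiv> TRI \<bullet> n"

lemma tri_suc [simp]: "tri (suc n) = tri n \<oplus> suc n"
  by (simp add: TRI_def tri_trm_def tval_lam del: lam.simps) (simp add: econs_def)

lemma tri_plus: "\<exists>k. tri (u \<oplus> d) = tri u \<oplus> k"
proof (rule ind[where P = "\<lambda>d. \<exists>k. tri (u \<oplus> d) = tri u \<oplus> k"])
  show "\<exists>k. tri (u \<oplus> zero) = tri u \<oplus> k" by (rule exI[of _ zero]) simp
next
  fix d assume "\<exists>k. tri (u \<oplus> d) = tri u \<oplus> k"
  then obtain k where "tri (u \<oplus> d) = tri u \<oplus> k" by blast
  then have "tri (u \<oplus> suc d) = tri u \<oplus> (k \<oplus> suc (u \<oplus> d))" by (simp add: plus_assoc)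
  then show "\<exists>k. tri (u \<oplus> suc d) = tri u \<oplus> k" by blast
qed (simp only: repr)

definition SNC :: 'a where "SNC = tval (\<lambda>_ _. zero) snoc_trm"
definition SEG :: 'a where "SEG = tval (\<lambda>_ _. zero) seg_trm"

abbreviation snc :: "'a \<Rightarrow> 'a \<Rightarrow> 'a" where "snc s x \<equiv> ap N T1 SNC s \<bullet> x"
abbreviation sg :: "'a \<Rightarrow> 'a \<Rightarrow> 'a" where "sg f n \<equiv> ap T1 T1 SEG f \<bullet> n"

lemma tval_snoc:
  "ty s = Some N \<Longrightarrow> ty m = Some N \<Longrightarrow> tval e (snoc s m) = snc (tval e s) (tval e m)"
  using tval_cong[of snoc_trm e "\<lambda>_ _. zero"] by (simp add: snoc_def SNC_def)

lemma tval_seg: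
  "ty f = Some T1 \<Longrightarrow> ty n = Some N \<Longrightarrow> tval e (seg f n) = sg (tval e f) (tval e n)"
  using tval_cong[of seg_trm e "\<lambda>_ _. zero"] by (simp add: seg_def SEG_def)

lemma snc_eq: "snc s x = suc (tri (s \<oplus> x) \<oplus> x)"
proof -
  have "tval e tri_trm = TRI" for e
    unfolding TRI_def by (rule tval_cong) (simp add: tri_trm_def Id_comb_def)
  then show ?thesis
    by (simp add: SNC_def snoc_trm_def tval_lam del: lam.simps) (simp add: econs_def)
qed

lemma sg_zero [simp]: "sg f zero = zero"
  by (simp add: SEG_def seg_trm_def snoc_def tval_lam del: lam.simps)

lemma sg_suc [simp]: "sg f (suc n) = snc (sg f n) (f \<bullet> n)"
proof -
  have "tval e snoc_trm = SNC" for e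
    unfolding SNC_def by (rule tval_cong) simp
  then show ?thesis
    by (simp add: SEG_def seg_trm_def snoc_def tval_lam del: lam.simps) (simp add: econs_def)
qed

lemma snc_nonzero [simp]: "snc s x \<noteq> zero" "zero \<noteq> snc s x"
  by (simp_all add: snc_eq suc_nonzero[symmetric] del: suc_nonzero) (metis suc_nonzero)+

text \<open>Injectivity of Cantor pairing. If \<open>s \<oplus> x \<prec> s' \<oplus> x'\<close>,
  then the triangular number of the larger sum exceeds the other one by at least
  \<open>suc (s \<oplus> x)\<close>, and the summand \<open>x\<close> cannot make up for that. So
  the sums agree, hence also \<open>x\<close> and \<open>x'\<close>.\<close>

lemma snc_inject [simp]: "snc s x = snc s' x' \<longleftrightarrow> s = s' \<and> x = x'"
proof -
  have *: False if eq: "tri (s \<oplus> x) \<oplus> x = tri (s' \<oplus> x') \<oplus> x'" and u: "s \<oplus> x \<prec> s' \<oplus> x'" for s x s' x'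
  proof -
    obtain d where d: "s' \<oplus> x' = suc (s \<oplus> x) \<oplus> d" using u by (auto simp: less_iff)
    obtain k where "tri (s' \<oplus> x') = tri (s \<oplus> x) \<oplus> suc (s \<oplus> x) \<oplus> k"
      using tri_plus[of "suc (s \<oplus> x)" d] by (auto simp: d)
    with eq have "tri (s \<oplus> x) \<oplus> x = tri (s \<oplus> x) \<oplus> (suc (s \<oplus> x) \<oplus> k \<oplus> x')"
      by (simp only: plus_assoc)
    then have "x = suc (s \<oplus> x) \<oplus> k \<oplus> x'" by (simp only: plus_cancel_left)
    also have "\<dots> = x \<oplus> suc (s \<oplus> (k \<oplus> x'))"
      by (simp add: plus_assoc plus_left_comm[of s x])
    finally have "x \<oplus> zero = x \<oplus> suc (s \<oplus> (k \<oplus> x'))" by (simp only: plus_zero)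
    then show False unfolding plus_cancel_left by (metis suc_nonzero)
  qed
  show ?thesis
  proof
    assume "snc s x = snc s' x'"
    then have eq: "tri (s \<oplus> x) \<oplus> x = tri (s' \<oplus> x') \<oplus> x'" by (simp add: snc_eq)
    then have u: "s \<oplus> x = s' \<oplus> x'" using * less_linear[of "s \<oplus> x" "s' \<oplus> x'"] by metis
    with eq have "x = x'" by simp
    with u show "s = s' \<and> x = x'" by simp
  qed simp
qed

text \<open>Choice for arithmetical predicates: \<open>pick\<close> selects the values, and the
  first assumption makes the selection internal.\<close>

lemma ex_function:
  assumes "repf N N (\<lambda>n. pick (P n))" "\<And>n. repf N N (\<lambda>m. chi (P n m))" "\<And>n. \<exists>m. P n m"
  shows "\<exists>f. \<forall>n. P n (f \<bullet> n)"
proof -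
  have "P n (L N N (\<lambda>n. pick (P n)) \<bullet> n)" for n
    unfolding L_beta[OF assms(1)] using assms(2,3) by (rule pickI)
  then show ?thesis by blast
qed

definition INIT :: 'a where "INIT = L N N (\<lambda>c. pick (\<lambda>s. \<exists>x. c = snc s x))"

lemma INIT_snc [simp]: "INIT \<bullet> snc s x = s"
proof -
  have "repf N N (\<lambda>c. pick (\<lambda>s. \<exists>x. c = snc s x))" by (simp only: repr)
  moreover have "\<exists>y. snc s x = snc (pick (\<lambda>t. \<exists>y. snc s x = snc t y)) y"
    by (rule pickI[of "\<lambda>t. \<exists>y. snc s x = snc t y"]) (simp only: repr, auto)
  ultimately show ?thesis by (simp add: INIT_def L_beta)
qed

text \<open>Iterating \<open>INIT\<close> removes the last \<open>j\<close> entries. This gives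
  access to initial segments without decoding individual entries.\<close>

abbreviation strip :: "'a \<Rightarrow> 'a \<Rightarrow> 'a" where "strip c j \<equiv> rec (KK N T1 INIT) c j"

text \<open>Removing one more entry starts from a segment longer by one, so \<open>k\<close> is
  universally quantified in the induction.\<close>

lemma strip_sg: "strip (sg f (k \<oplus> j)) j = sg f k"
proof -
  have "\<forall>k. strip (sg f (k \<oplus> j)) j = sg f k"
  proof (rule ind[where P = "\<lambda>j. \<forall>k. strip (sg f (k \<oplus> j)) j = sg f k"])
    fix j assume *: "\<forall>k. strip (sg f (k \<oplus> j)) j = sg f k"
    show "\<forall>k. strip (sg f (k \<oplus> suc j)) (suc j) = sg f k"
    proof
      fix k
      from * have "strip (sg f (suc k \<oplus> j)) j = sg f (suc k)" by blast
      then show "strip (sg f (k \<oplus> suc j)) (suc j) = sg f k" by simp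
    qed
  qed (simp only: repr, simp)
  then show ?thesis by blast
qed

text \<open>\<open>INIT\<close> has no meaningful value at the empty code, so stripping beyond it is
  uncontrolled. Therefore the first arrival at zero is taken.\<close>

definition LEN :: 'a where
  "LEN = L N N (\<lambda>c. pick (\<lambda>n. strip c n = zero \<and> (\<forall>j. j \<prec> n \<longrightarrow> strip c j \<noteq> zero)))"

lemma LEN_sg: "LEN \<bullet> sg f n = n"
proof -
  let ?P = "\<lambda>c n. strip c n = zero \<and> (\<forall>j. j \<prec> n \<longrightarrow> strip c j \<noteq> zero)"
  have P: "?P (sg f n) n"
  proof (intro conjI allI impI)
    show "strip (sg f n) n = zero" using strip_sg[of f zero n] by simp
  next
    fix j assume "j \<prec> n"
    then obtain d where "n = j \<oplus> suc d" by (auto simp: less_iff)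
    then have "n = suc d \<oplus> j" by (simp add: plus_comm)
    then have "strip (sg f n) j = sg f (suc d)" using strip_sg[of f "suc d" j] by simp
    then show "strip (sg f n) j \<noteq> zero" by simp
  qed
  have r: "repf N N (\<lambda>c. pick (?P c))" by (simp only: repr)
  define p where "p = pick (?P (sg f n))"
  have "?P (sg f n) p"
    unfolding p_def by (rule pickI[of "?P (sg f n)"]) (simp only: repr, use P in blast)
  then have "p = n" using P less_linear[of n p] by blast
  moreover have "LEN \<bullet> sg f n = p"
    unfolding LEN_def p_def by (rule L_beta[OF r])
  ultimately show ?thesis by simp
qed

end


section \<open>The principles in the model\<close>

lemma ty_snoc [simp]: "ty s = Some N \<Longrightarrow> ty m = Some N \<Longrightarrow> ty (snoc s m) = Some N"
  by (simp add: snoc_def)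

lemma ty_seg [simp]: "ty f = Some T1 \<Longrightarrow> ty n = Some N \<Longrightarrow> ty (seg f n) = Some N"
  by (simp add: seg_def)

definition kl_formula :: "fm \<Rightarrow> fm" where
  "kl_formula A = Imp (finitely_branching A)
     (Imp (Forall N (Exists T1 (Forall N (Imp (Leq (Var N 0) (Var N 1))
                                    (inst [(N, seg (Var T1 0) (Var N 0))] [N, T1, N] A)))))
          (Exists T1 (Forall N (inst [(N, seg (Var T1 0) (Var N 0))] [N, T1] A))))"

lemma Phi1_KL_eq: "Phi1_KL = {kl_formula (All_Cantor B) | B. wff B \<and> arithmetical B}"
  by (auto simp: Phi1_KL_def kl_formula_def)

context aca_model
begin

abbreviation app3 :: "'a \<Rightarrow> 'a \<Rightarrow> 'a \<Rightarrow> 'a \<Rightarrow> 'a" where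
  "app3 Y n m f \<equiv> ap T1 N (ap N T2 (ap N (N \<rightarrow> T2) Y n) m) f"

abbreviation app2 :: "'a \<Rightarrow> 'a \<Rightarrow> 'a \<Rightarrow> 'a" where
  "app2 Y c f \<equiv> ap T1 N (ap N T2 Y c) f"

abbreviation leq :: "'a \<Rightarrow> 'a \<Rightarrow> bool" (infix "\<preceq>" 50) where
  "x \<preceq> y \<equiv> x \<prec> y \<or> x = y"

definition binary :: "'a \<Rightarrow> bool" where
  "binary g \<longleftrightarrow> (\<forall>n. g \<bullet> n = zero \<or> g \<bullet> n = suc zero)"

definition enc_principle :: bool where
  "enc_principle \<longleftrightarrow> (\<forall>Y. (\<forall>n. \<exists>m. \<forall>f. app3 Y n m f = zero)
     \<longrightarrow> (\<exists>g. \<forall>n f. app3 Y n (g \<bullet> n) f = zero))"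

definition bnc_principle :: bool where
  "bnc_principle \<longleftrightarrow> (\<forall>Y. (\<forall>n. \<exists>m. \<forall>f. app3 Y n m f = zero)
     \<longrightarrow> (\<exists>g. \<forall>n. \<exists>m. m \<preceq> g \<bullet> n \<and> (\<forall>f. app3 Y n m f = zero)))"

definition in_tree :: "'a \<Rightarrow> 'a \<Rightarrow> bool" where
  "in_tree Y c \<longleftrightarrow> (\<forall>g. binary g \<longrightarrow> app2 Y c g = zero)"

definition kl_principle :: bool where
  "kl_principle \<longleftrightarrow> (\<forall>Y.
     (\<forall>c. in_tree Y c \<longrightarrow> (\<exists>n. \<forall>m. in_tree Y (snc c m) \<longrightarrow> m \<preceq> n))
     \<longrightarrow> (\<forall>n. \<exists>f. \<forall>m. m \<preceq> n \<longrightarrow> in_tree Y (sg f m))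
     \<longrightarrow> (\<exists>f. \<forall>n. in_tree Y (sg f n)))"

definition sind_principle :: bool where
  "sind_principle \<longleftrightarrow> (\<forall>Z. (\<exists>f. ap T1 T1 Z f \<bullet> zero = zero)
     \<longrightarrow> (\<forall>n. (\<exists>f. ap T1 T1 Z f \<bullet> n = zero) \<longrightarrow> (\<exists>f. ap T1 T1 Z f \<bullet> suc n = zero))
     \<longrightarrow> (\<forall>n. \<exists>f. ap T1 T1 Z f \<bullet> n = zero))"

section \<open>Passing between the schemes and statements about one internal object\<close>

lemma econs_simps [simp]:
  "econs \<tau> x e \<tau> 0 = x" "econs \<tau> x e \<tau> (Suc i) = e \<tau> i" "\<sigma> \<noteq> \<tau> \<Longrightarrow> econs \<tau> x e \<sigma> i = e \<sigma> i"
  by (simp_all add: econs_def)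

text \<open>One atomic instance of the scheme with \<open>Y\<close> as parameter yields the
  principle. Conversely, \<open>repr_formula3\<close> turns each instance into one for a suitable
  \<open>Y\<close>. \<open>BNC\<close> and \<open>\<Phi>\<^sub>1-KL\<close> are treated
  alike.\<close>

lemma enc_if_scheme:
  assumes "\<And>\<phi> e. \<phi> \<in> ENC \<Longrightarrow> wff \<phi> \<Longrightarrow> sat e \<phi>"
  shows enc_principle
  unfolding enc_principle_def
proof (intro allI)
  fix Y
  let ?\<psi> = "Eq (Var (N \<rightarrow> N \<rightarrow> T2) 0 \<cdot> Var N 1 \<cdot> Var N 0 \<cdot> Var T1 0) Zer"
  let ?\<phi> = "Imp (Forall N (Exists N (Forall T1 ?\<psi>)))
    (Exists T1 (Forall N (inst [(N, Var T1 0 \<cdot> Var N 0), (N, Var N 0)] [N, T1] (Forall T1 ?\<psi>))))"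
  have "?\<phi> \<in> ENC" unfolding ENC_def by (rule CollectI, intro exI[of _ ?\<psi>] exI conjI refl) simp_all
  from assms[OF this, of "\<lambda>_ _. Y"]
  show "(\<forall>n. \<exists>m. \<forall>f. app3 Y n m f = zero) \<longrightarrow> (\<exists>g. \<forall>n f. app3 Y n (g \<bullet> n) f = zero)"
    by (simp add: wff_inst sat_inst)
qed

lemma scheme_if_enc:
  assumes "enc_principle" "\<phi> \<in> ENC"
  shows "sat e \<phi>"
proof -
  obtain \<psi> where \<psi>: "wff \<psi>" "arithmetical \<psi>" and \<phi>: "\<phi> = Imp (Forall N (Exists N (Forall T1 \<psi>)))
      (Exists T1 (Forall N (inst [(N, Var T1 0 \<cdot> Var N 0), (N, Var N 0)] [N, T1] (Forall T1 \<psi>))))"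
    using assms(2) by (auto simp: ENC_def)
  obtain Y where Y: "\<And>n m f. app3 Y n m f = chi (sat (econs T1 f (econs N m (econs N n e))) \<psi>)"
    using repr_formula3[OF \<psi>] by blast
  have "(\<forall>n. \<exists>m. \<forall>f. app3 Y n m f = zero) \<longrightarrow> (\<exists>g. \<forall>n f. app3 Y n (g \<bullet> n) f = zero)"
    using assms(1) unfolding enc_principle_def by blast
  then show ?thesis unfolding \<phi> by (simp add: sat_inst Y)
qed

lemma bnc_if_scheme:
  assumes "\<And>\<phi> e. \<phi> \<in> BNC \<Longrightarrow> wff \<phi> \<Longrightarrow> sat e \<phi>"
  shows bnc_principle
  unfolding bnc_principle_def
proof (intro allI)
  fix Y
  let ?\<psi> = "Eq (Var (N \<rightarrow> N \<rightarrow> T2) 0 \<cdot> Var N 1 \<cdot> Var N 0 \<cdot> Var T1 0) Zer"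
  let ?\<phi> = "Imp (Forall N (Exists N (Forall T1 ?\<psi>)))
    (Exists T1 (Forall N (Exists N (And (Leq (Var N 0) (Var T1 0 \<cdot> Var N 1))
       (inst [(N, Var N 0), (N, Var N 1)] [N, N, T1] (Forall T1 ?\<psi>))))))"
  have "?\<phi> \<in> BNC" unfolding BNC_def by (rule CollectI, intro exI[of _ ?\<psi>] exI conjI refl) simp_all
  from assms[OF this, of "\<lambda>_ _. Y"]
  show "(\<forall>n. \<exists>m. \<forall>f. app3 Y n m f = zero)
      \<longrightarrow> (\<exists>g. \<forall>n. \<exists>m. m \<preceq> g \<bullet> n \<and> (\<forall>f. app3 Y n m f = zero))"
    by (simp add: wff_inst sat_inst disj_imp)
qed

lemma scheme_if_bnc:
  assumes bnc_principle "\<phi> \<in> BNC"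
  shows "sat e \<phi>"
proof -
  obtain \<psi> where \<psi>: "wff \<psi>" "arithmetical \<psi>" and \<phi>: "\<phi> = Imp (Forall N (Exists N (Forall T1 \<psi>)))
      (Exists T1 (Forall N (Exists N (And (Leq (Var N 0) (Var T1 0 \<cdot> Var N 1))
         (inst [(N, Var N 0), (N, Var N 1)] [N, N, T1] (Forall T1 \<psi>))))))"
    using assms(2) by (auto simp: BNC_def)
  obtain Y where Y: "\<And>n m f. app3 Y n m f = chi (sat (econs T1 f (econs N m (econs N n e))) \<psi>)"
    using repr_formula3[OF \<psi>] by blast
  have "(\<forall>n. \<exists>m. \<forall>f. app3 Y n m f = zero)
      \<longrightarrow> (\<exists>g. \<forall>n. \<exists>m. m \<preceq> g \<bullet> n \<and> (\<forall>f. app3 Y n m f = zero))"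
    using assms(1) unfolding bnc_principle_def by blast
  then show ?thesis unfolding \<phi> by (simp add: sat_inst Y disj_imp)
qed

lemma sat_All_Cantor: "sat e (All_Cantor B) \<longleftrightarrow> (\<forall>g. binary g \<longrightarrow> sat (econs T1 g e) B)"
  by (simp add: All_Cantor_def binary_def disj_imp)

lemma sat_finitely_branching:
  "sat e (finitely_branching A) \<longleftrightarrow> (\<forall>c. sat (econs N c e) A
     \<longrightarrow> (\<exists>n. \<forall>m. sat (econs N (snc c m) e) A \<longrightarrow> m \<preceq> n))"
  by (simp add: finitely_branching_def sat_inst tval_snoc numeral_2_eq_2 disj_imp)

lemma sat_kl_formula:
  "sat e (kl_formula A) \<longleftrightarrow>
     ((\<forall>c. sat (econs N c e) A \<longrightarrow> (\<exists>n. \<forall>m. sat (econs N (snc c m) e) A \<longrightarrow> m \<preceq> n))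
     \<longrightarrow> (\<forall>n. \<exists>f. \<forall>m. m \<preceq> n \<longrightarrow> sat (econs N (sg f m) e) A)
     \<longrightarrow> (\<exists>f. \<forall>n. sat (econs N (sg f n) e) A))"
  by (simp add: kl_formula_def sat_finitely_branching sat_inst tval_seg disj_imp)

lemma kl_if_scheme:
  assumes "\<And>\<phi> e. \<phi> \<in> Phi1_KL \<Longrightarrow> wff \<phi> \<Longrightarrow> sat e \<phi>"
  shows kl_principle
  unfolding kl_principle_def
proof (intro allI)
  fix Y
  let ?B = "Eq (Var (N \<rightarrow> T2) 0 \<cdot> Var N 0 \<cdot> Var T1 0) Zer"
  have "kl_formula (All_Cantor ?B) \<in> Phi1_KL"
    unfolding Phi1_KL_eq by (rule CollectI, intro exI[of _ ?B] conjI refl) simp_all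
  moreover have "wff (kl_formula (All_Cantor ?B))"
    by (simp add: kl_formula_def finitely_branching_def wff_inst All_Cantor_def)
  ultimately have "sat (\<lambda>_ _. Y) (kl_formula (All_Cantor ?B))" by (rule assms)
  then show "(\<forall>c. in_tree Y c \<longrightarrow> (\<exists>n. \<forall>m. in_tree Y (snc c m) \<longrightarrow> m \<preceq> n))
     \<longrightarrow> (\<forall>n. \<exists>f. \<forall>m. m \<preceq> n \<longrightarrow> in_tree Y (sg f m))
     \<longrightarrow> (\<exists>f. \<forall>n. in_tree Y (sg f n))"
    by (simp add: sat_kl_formula sat_All_Cantor in_tree_def)
qed

lemma scheme_if_kl:
  assumes kl_principle "\<phi> \<in> Phi1_KL"
  shows "sat e \<phi>"
proof -
  obtain B where B: "wff B" "arithmetical B" and \<phi>: "\<phi> = kl_formula (All_Cantor B)"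
    using assms(2) by (auto simp: Phi1_KL_eq)
  obtain Y where Y: "\<And>c g. app2 Y c g = chi (sat (econs T1 g (econs N c e)) B)"
    using repr_formula2[OF B] by blast
  have "sat (econs N c e) (All_Cantor B) \<longleftrightarrow> in_tree Y c" for c
    by (simp add: sat_All_Cantor in_tree_def Y)
  then show ?thesis
    using assms(1) unfolding kl_principle_def \<phi> sat_kl_formula by simp
qed

lemma sat_Sigma_IND: "sat e Sigma_IND \<longleftrightarrow> sind_principle"
  unfolding sind_principle_def Sigma_IND_def Let_def by (simp add: imp_conv_disj)


section \<open>The equivalence in the model\<close>

lemma bnc_if_enc:
  assumes enc_principle
  shows bnc_principle
  unfolding bnc_principle_def
proof (intro allI impI)
  fix Y assume "\<forall>n. \<exists>m. \<forall>f. app3 Y n m f = zero"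
  with assms obtain g where g: "\<forall>n f. app3 Y n (g \<bullet> n) f = zero"
    unfolding enc_principle_def by blast
  show "\<exists>g. \<forall>n. \<exists>m. m \<preceq> g \<bullet> n \<and> (\<forall>f. app3 Y n m f = zero)"
  proof (intro exI allI)
    fix n show "g \<bullet> n \<preceq> g \<bullet> n \<and> (\<forall>f. app3 Y n (g \<bullet> n) f = zero)" using g by blast
  qed
qed

section \<open>Koenig's lemma from \<open>ENC\<close>\<close>

lemma L3_beta:
  assumes "repf N (N \<rightarrow> T2) (\<lambda>n. L N T2 (\<lambda>m. L T1 N (\<lambda>f. G n m f)))"
    "\<And>n. repf N T2 (\<lambda>m. L T1 N (\<lambda>f. G n m f))" "\<And>n m. repf T1 N (\<lambda>f. G n m f)"
  shows "app3 (L N (N \<rightarrow> T2) (\<lambda>n. L N T2 (\<lambda>m. L T1 N (\<lambda>f. G n m f)))) n m f = G n m f"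
  unfolding L_beta[OF assms(1)] L_beta[OF assms(2)] L_beta[OF assms(3)] ..

lemma L2_beta:
  assumes "repf N T2 (\<lambda>m. L T1 N (\<lambda>f. G m f))" "\<And>m. repf T1 N (\<lambda>f. G m f)"
  shows "app2 (L N T2 (\<lambda>m. L T1 N (\<lambda>f. G m f))) m f = G m f"
  unfolding L_beta[OF assms(1)] L_beta[OF assms(2)] ..

lemma L11_beta:
  assumes "repf N T1 (\<lambda>m. L N N (\<lambda>f. G m f))" "\<And>m. repf N N (\<lambda>f. G m f)"
  shows "ap N T1 (L N T1 (\<lambda>m. L N N (\<lambda>f. G m f))) m \<bullet> f = G m f"
  unfolding L_beta[OF assms(1)] L_beta[OF assms(2)] ..

text \<open>The code \<open>c\<close> behaves like that of a sequence of length \<open>n\<close>.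
  Stated through \<open>strip\<close>, this is arithmetical and may enter the matrix of an
  \<open>ENC\<close> instance, unlike the existence of a function with segment
  \<open>c\<close>.\<close>

definition seq_code :: "'a \<Rightarrow> 'a \<Rightarrow> bool" where
  "seq_code n c \<longleftrightarrow> strip c n = zero \<and>
     (\<forall>j. j \<prec> n \<longrightarrow> (\<exists>x. strip c j = snc (strip c (suc j)) x))"

lemma seq_code_sg: "seq_code n (sg f n)"
  unfolding seq_code_def
proof (intro conjI allI impI)
  show "strip (sg f n) n = zero" using strip_sg[of f zero n] by simp
next
  fix j assume "j \<prec> n"
  then obtain d where "n = j \<oplus> suc d" by (auto simp: less_iff)
  then have "n = d \<oplus> suc j" "n = suc d \<oplus> j" by (simp_all add: plus_comm)
  then have "strip (sg f n) (suc j) = sg f d" "strip (sg f n) j = sg f (suc d)"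
    by (metis strip_sg)+
  then show "\<exists>x. strip (sg f n) j = snc (strip (sg f n) (suc j)) x" by auto
qed

text \<open>Bounded collection by induction on \<open>b\<close>: the sum
  \<open>m \<oplus> m'\<close> dominates both the old bound and the one for the new
  \<open>x\<close>.\<close>

lemma collection:
  assumes "repf N N (\<lambda>b. chi (\<exists>m. \<forall>x. x \<prec> b \<longrightarrow> (\<forall>j. m \<prec> j \<longrightarrow> P x j)))"
    and "\<And>x. \<exists>m. \<forall>j. m \<prec> j \<longrightarrow> P x j"
  shows "\<exists>m. \<forall>x. x \<prec> b \<longrightarrow> (\<forall>j. m \<prec> j \<longrightarrow> P x j)"
proof (rule ind[where P = "\<lambda>b. \<exists>m. \<forall>x. x \<prec> b \<longrightarrow> (\<forall>j. m \<prec> j \<longrightarrow> P x j)", OF assms(1)])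
  fix b assume "\<exists>m. \<forall>x. x \<prec> b \<longrightarrow> (\<forall>j. m \<prec> j \<longrightarrow> P x j)"
  then obtain m where m: "\<forall>x. x \<prec> b \<longrightarrow> (\<forall>j. m \<prec> j \<longrightarrow> P x j)" by blast
  obtain m' where m': "\<forall>j. m' \<prec> j \<longrightarrow> P b j" using assms(2)[of b] by blast
  have "P x j" if "x \<prec> suc b" "m \<oplus> m' \<prec> j" for x j
    using m m' that(1) plus_lessD[OF that(2)] unfolding less_suc by blast
  then show "\<exists>m. \<forall>x. x \<prec> suc b \<longrightarrow> (\<forall>j. m \<prec> j \<longrightarrow> P x j)" by blast
qed simp

lemma kl_if_enc:
  assumes enc_principle
  shows kl_principle
  unfolding kl_principle_def
proof (intro allI impI)
  fix Y
  let ?A = "in_tree Y"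
  assume branch: "\<forall>c. ?A c \<longrightarrow> (\<exists>n. \<forall>m. ?A (snc c m) \<longrightarrow> m \<preceq> n)"
    and long: "\<forall>n. \<exists>f. \<forall>m. m \<preceq> n \<longrightarrow> ?A (sg f m)"
  \<comment> \<open>The universal quantifier over Cantor space commutes with the bounded number
    quantifier, so "all initial segments of \<open>c\<close> lie in the tree" has the form required
    by \<open>ENC\<close>, with the restriction to binary functions moved into the matrix.\<close>
  let ?G = "\<lambda>n c f. chi (seq_code n c \<and> (binary f \<longrightarrow> (\<forall>j. j \<preceq> n \<longrightarrow> app2 Y (strip c j) f = zero)))"
  let ?Y = "L N (N \<rightarrow> T2) (\<lambda>n. L N T2 (\<lambda>c. L T1 N (\<lambda>f. ?G n c f)))"
  have Y: "app3 ?Y n c f = ?G n c f" for n c f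
    by (rule L3_beta) (simp_all only: repr seq_code_def binary_def)
  have "\<exists>c. \<forall>f. app3 ?Y n c f = zero" for n
  proof -
    obtain f where f: "\<And>m. m \<preceq> n \<Longrightarrow> ?A (sg f m)" using long by blast
    have T: "?A (strip (sg f n) j)" if "j \<preceq> n" for j
    proof -
      \<comment> \<open>Stripping \<open>j\<close> entries from a segment of length \<open>n\<close>
        leaves the one of length \<open>d = n - j\<close>.\<close>
      from that obtain d where "n = j \<oplus> d" by (metis less_iff plus_zero)
      then have n: "n = d \<oplus> j" by (simp add: plus_comm)
      then have "d \<preceq> n" using nat_cases[of j] by (auto simp: less_iff)
      with f show ?thesis using n strip_sg by metis
    qed
    have "\<forall>h. app3 ?Y n (sg f n) h = zero"
      unfolding Y chi_eq_zero using seq_code_sg T unfolding in_tree_def by blast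
    then show ?thesis by blast
  qed
  then obtain c where "\<And>n f. app3 ?Y n (c \<bullet> n) f = zero"
    using assms unfolding enc_principle_def by blast
  then have code: "seq_code n (c \<bullet> n)" and A: "\<And>j. j \<preceq> n \<Longrightarrow> ?A (strip (c \<bullet> n) j)" for n
    unfolding Y chi_eq_zero in_tree_def by blast+
  \<comment> \<open>\<open>s\<close> is the initial segment of length \<open>k\<close> of the chosen
    path of length \<open>k \<oplus> j\<close>, for unboundedly many \<open>j\<close>. This
    arithmetical condition replaces having infinitely many extensions.\<close>
  define good where "good = (\<lambda>s k. \<forall>m. \<exists>j. m \<prec> j \<and> strip (c \<bullet> (k \<oplus> j)) j = s)"
  have good_A: "?A s" if "good s k" for s k
  proof -
    obtain j where "strip (c \<bullet> (k \<oplus> j)) j = s" using \<open>good s k\<close> unfolding good_def by blast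
    moreover have "j \<preceq> k \<oplus> j" using nat_cases[of k] by (auto simp: less_iff plus_comm)
    ultimately show ?thesis using A by metis
  qed
  have good_step: "\<exists>x. good (snc s x) (suc k)" if g: "good s k" for s k
  proof (rule ccontr)
    assume no: "\<nexists>x. good (snc s x) (suc k)"
    obtain b where b: "\<And>x. ?A (snc s x) \<Longrightarrow> x \<preceq> b" using branch good_A[OF g] by blast
    \<comment> \<open>Every child in the tree has last entry at most \<open>b\<close>, hence below
      \<open>suc b\<close>. If no child is good, then past a common \<open>m\<close> none of these
      candidates occurs in a chosen path.\<close>
    have "\<exists>m. \<forall>x. x \<prec> suc b \<longrightarrow> (\<forall>j. m \<prec> j \<longrightarrow> strip (c \<bullet> (suc k \<oplus> j)) j \<noteq> snc s x)"
      by (rule collection) (simp only: repr, use no in \<open>unfold good_def, blast\<close>)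
    then obtain m where m:
      "\<And>x j. x \<prec> suc b \<Longrightarrow> m \<prec> j \<Longrightarrow> strip (c \<bullet> (suc k \<oplus> j)) j \<noteq> snc s x" by blast
    \<comment> \<open>Passing from length \<open>k\<close> to \<open>suc k\<close> costs one strip:
      the predecessor \<open>j\<close> of \<open>i\<close> must still exceed
      \<open>m\<close>.\<close>
    obtain i where i: "suc m \<prec> i" "strip (c \<bullet> (k \<oplus> i)) i = s" using g unfolding good_def by blast
    then obtain j where j: "i = suc j" using nat_cases[of i] by auto
    have n: "k \<oplus> i = suc k \<oplus> j" by (simp add: j)
    have "m \<prec> j" using i(1) suc_less_sucD by (simp add: j)
    have jn: "j \<prec> suc k \<oplus> j" unfolding less_iff using plus_comm[of "suc k" j] by blast
    then obtain x where x: "strip (c \<bullet> (suc k \<oplus> j)) j = snc (strip (c \<bullet> (suc k \<oplus> j)) (suc j)) x"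
      using code unfolding seq_code_def by blast
    then have x: "strip (c \<bullet> (suc k \<oplus> j)) j = snc s x" using i(2) unfolding n unfolding j by simp
    have "x \<prec> suc b" using b A[of j "suc k \<oplus> j"] jn x by (auto simp: less_suc)
    then show False using m \<open>m \<prec> j\<close> x by blast
  qed
  define h where "h = (\<lambda>k s. pick (\<lambda>x. good (snc s x) (suc k)))"
  have h: "good (snc s (h k s)) (suc k)" if "good s k" for s k
    unfolding h_def
    by (rule pickI[of "\<lambda>x. good (snc s x) (suc k)"])
      (simp only: repr good_def, use good_step[OF that] in blast)
  \<comment> \<open>The recursion runs on codes, because the next entry depends on the whole segment
    built so far. Afterwards \<open>f\<close> lists the entries.\<close>
  define F where "F = L N T1 (\<lambda>k. L N N (\<lambda>s. snc s (h k s)))"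
  have F: "ap N T1 F k \<bullet> s = snc s (h k s)" for k s
    \<comment> \<open>the bracket abstractions nest too deeply for the default limit\<close>
    using [[simp_depth_limit = 1000]] unfolding F_def h_def good_def
    by (rule L11_beta) (simp_all only: repr)
  define f where "f = L N N (\<lambda>k. h k (rec F zero k))"
  have f: "f \<bullet> k = h k (rec F zero k)" for k
    unfolding f_def by (rule L_beta) (simp only: repr h_def good_def)
  have sg: "sg f k = rec F zero k" for k
    by (rule ind[where P = "\<lambda>k. sg f k = rec F zero k"]) (simp only: repr, simp_all add: F f)
  have "good (rec F zero k) k" for k
  proof (rule ind[where P = "\<lambda>k. good (rec F zero k) k"])
    \<comment> \<open>A chosen path of length \<open>j\<close>, stripped \<open>j\<close> times, is
      empty. Above a given \<open>m\<close> the number \<open>j = suc m\<close> serves.\<close>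
    show "good (rec F zero zero) zero"
      using code unfolding good_def seq_code_def by (auto simp: less_suc intro!: exI[of _ "suc _"])
  next
    fix k assume "good (rec F zero k) k"
    then show "good (rec F zero (suc k)) (suc k)" using h by (simp add: F)
  qed (simp only: repr good_def)
  then have "?A (sg f n)" for n unfolding sg using good_A by blast
  then show "\<exists>f. \<forall>n. ?A (sg f n)" by blast
qed

text \<open>A single function \<open>f\<close> codes the family of functions \<open>sec f c\<close>.\<close>

abbreviation sec :: "'a \<Rightarrow> 'a \<Rightarrow> 'a" where "sec f c \<equiv> L N N (\<lambda>k. f \<bullet> snc c k)"

lemma sec: "sec f c \<bullet> k = f \<bullet> snc c k"
  by (rule L_beta) (simp only: repr)

section \<open>Partial sums and low sequences\<close>

abbreviation psum :: "'a \<Rightarrow> 'a \<Rightarrow> 'a" where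
  "psum t k \<equiv> rec (L N T1 (\<lambda>i. L N N (\<lambda>r. r \<oplus> t \<bullet> i))) zero k"

lemma psum_suc: "psum t (suc k) = psum t k \<oplus> t \<bullet> k"
proof -
  have "ap N T1 (L N T1 (\<lambda>i. L N N (\<lambda>r. r \<oplus> t \<bullet> i))) k \<bullet> r = r \<oplus> t \<bullet> k" for r
    by (rule L11_beta) (simp_all only: repr)
  then show ?thesis by simp
qed

lemma psum_zero:
  assumes "\<And>i. t \<bullet> i = zero"
  shows "psum t k = zero"
proof (rule ind[where P = "\<lambda>k. psum t k = zero"])
  fix k assume "psum t k = zero"
  then show "psum t (suc k) = zero" unfolding psum_suc using assms by simp
qed (simp only: repr, rule rec_zero)

text \<open>The excess of the larger sum is carried along as an explicit summand, so each induction
  step just adds the excess at one index.\<close>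

lemma psum_mono:
  assumes "\<And>i. i \<prec> n \<Longrightarrow> t \<bullet> i \<preceq> g \<bullet> i"
  shows "\<exists>d. psum g n = psum t n \<oplus> d"
proof -
  have "k \<preceq> n \<longrightarrow> (\<exists>d. psum g k = psum t k \<oplus> d)" for k
  proof (rule ind[where P = "\<lambda>k. k \<preceq> n \<longrightarrow> (\<exists>d. psum g k = psum t k \<oplus> d)"])
    fix k assume IH: "k \<preceq> n \<longrightarrow> (\<exists>d. psum g k = psum t k \<oplus> d)"
    show "suc k \<preceq> n \<longrightarrow> (\<exists>d. psum g (suc k) = psum t (suc k) \<oplus> d)"
    proof
      assume "suc k \<preceq> n"
      then have k: "k \<prec> n" using less_trans[of k "suc k" n] by (auto simp: less_suc)
      then obtain d where d: "psum g k = psum t k \<oplus> d" using IH by blast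
      obtain d' where d': "g \<bullet> k = t \<bullet> k \<oplus> d'" using assms[OF k] by (metis less_iff plus_zero)
      have "psum g (suc k) = psum t (suc k) \<oplus> (d \<oplus> d')"
        unfolding psum_suc d d' by (simp only: plus_assoc plus_left_comm[of d])
      then show "\<exists>d. psum g (suc k) = psum t (suc k) \<oplus> d" by blast
    qed
  qed (simp only: repr, simp)
  then show ?thesis by blast
qed

text \<open>Both halves share one induction, since the step at \<open>n = i\<close> leads from the
  first to the second.\<close>

lemma psum_incr:
  assumes "t' \<bullet> i = suc (t \<bullet> i)" "\<And>j. j \<noteq> i \<Longrightarrow> t' \<bullet> j = t \<bullet> j"
  shows "(n \<preceq> i \<longrightarrow> psum t' n = psum t n) \<and> (i \<prec> n \<longrightarrow> psum t' n = suc (psum t n))"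
proof (rule ind[where P = "\<lambda>n. (n \<preceq> i \<longrightarrow> psum t' n = psum t n) \<and>
    (i \<prec> n \<longrightarrow> psum t' n = suc (psum t n))"])
  fix n
  assume IH: "(n \<preceq> i \<longrightarrow> psum t' n = psum t n) \<and> (i \<prec> n \<longrightarrow> psum t' n = suc (psum t n))"
  consider "n \<prec> i" | "n = i" | "i \<prec> n" using less_linear by blast
  then show "(suc n \<preceq> i \<longrightarrow> psum t' (suc n) = psum t (suc n)) \<and>
    (i \<prec> suc n \<longrightarrow> psum t' (suc n) = suc (psum t (suc n)))"
  proof cases
    case 1
    then have "n \<noteq> i" "\<not> i \<prec> suc n" using less_trans[of i n i] by (auto simp: less_suc)
    with 1 IH assms(2)[of n] show ?thesis unfolding psum_suc by simp
  next
    case 2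
    have "\<not> suc i \<preceq> i" using less_trans[of i "suc i" i] less_irrefl less_suc by metis
    with 2 IH assms(1) show ?thesis unfolding psum_suc by simp
  next
    case 3
    then have "n \<noteq> i" "\<not> suc n \<preceq> i"
      using less_trans[of n "suc n" i] less_trans[of i n i] less_irrefl less_suc by metis+
    with 3 IH assms(2)[of n] show ?thesis unfolding psum_suc by simp
  qed
qed (simp only: repr, simp)

text \<open>A sequence \<open>t\<close> is low if its entries are at most the least solutions; this is witnessed by
  counterexamples for all smaller values.  A low sequence of maximal sum consists of solutions.\<close>

definition low :: "'a \<Rightarrow> 'a \<Rightarrow> 'a \<Rightarrow> 'a \<Rightarrow> bool" where
  "low Y n f s \<longleftrightarrow> psum (sec f zero) n = s \<and>
     (\<forall>i. i \<prec> n \<longrightarrow> (\<forall>m. m \<prec> f \<bullet> snc zero i \<longrightarrow> app3 Y i m (sec f (snc i m)) \<noteq> zero))"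

text \<open>Raising entry \<open>i\<close> by one creates a single new value below it, the old
  entry. The function \<open>h\<close> is the counterexample to be stored for that value.\<close>

lemma low_increment:
  assumes low: "low Y n f s" and i: "i \<prec> n" and h: "app3 Y i (f \<bullet> snc zero i) h \<noteq> zero"
  shows "\<exists>f'. low Y n f' (suc s)"
proof -
  let ?a = "snc zero i" and ?b = "snc i (f \<bullet> snc zero i)"
  \<comment> \<open>Position \<open>?a\<close> holds entry \<open>i\<close>, and the positions
    \<open>snc ?b k\<close> are to hold the values of \<open>h\<close>. Everything else is kept.
    Since zero is not a \<open>snc\<close>, entries and counterexamples occupy disjoint
    positions.\<close>
  let ?P = "\<lambda>z y. (z = ?a \<and> y = suc (f \<bullet> ?a)) \<or> (z \<noteq> ?a \<and> (\<exists>k. z = snc ?b k \<and> y = h \<bullet> k))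
    \<or> (z \<noteq> ?a \<and> \<not> (\<exists>k. z = snc ?b k) \<and> y = f \<bullet> z)"
  have "\<exists>f'. \<forall>z. ?P z (f' \<bullet> z)"
  proof (rule ex_function[of ?P])
    show "repf N N (\<lambda>z. pick (?P z))" by (simp only: repr)
    show "repf N N (\<lambda>y. chi (?P z y))" for z by (simp only: repr)
    show "\<exists>y. ?P z y" for z by blast
  qed
  then obtain f' where f': "\<And>z. ?P z (f' \<bullet> z)" by blast
  have f'a: "f' \<bullet> ?a = suc (f \<bullet> ?a)" using f'[of ?a] by auto
  have f'0: "f' \<bullet> snc zero j = f \<bullet> snc zero j" if "j \<noteq> i" for j
    using f'[of "snc zero j"] that by auto
  have f'b: "sec f' ?b = h"
  proof (rule ap_ext[of N N])
    fix k show "sec f' ?b \<bullet> k = h \<bullet> k" using f'[of "snc ?b k"] by (auto simp: sec)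
  qed
  have f'c: "sec f' (snc j m) = sec f (snc j m)" if "snc j m \<noteq> ?b" for j m
  proof (rule ap_ext[of N N])
    fix k show "sec f' (snc j m) \<bullet> k = sec f (snc j m) \<bullet> k"
      using f'[of "snc (snc j m) k"] that by (auto simp: sec)
  qed
  have "psum (sec f' zero) n = suc (psum (sec f zero) n)"
    using psum_incr[of "sec f' zero" i "sec f zero" n] i f'a f'0 by (simp add: sec)
  moreover have "app3 Y j m (sec f' (snc j m)) \<noteq> zero" if j: "j \<prec> n" and m: "m \<prec> f' \<bullet> snc zero j" for j m
  proof (cases "snc j m = ?b")
    case True
    then have "j = i" "m = f \<bullet> ?a" by simp_all
    then show ?thesis using h f'b by simp
  next
    case False
    then have "m \<prec> f \<bullet> snc zero j" using m f'a f'0[of j] by (cases "j = i") (auto simp: less_suc)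
    then show ?thesis using low j f'c[OF False] unfolding low_def by simp
  qed
  ultimately have "low Y n f' (suc s)" using low unfolding low_def by simp
  then show ?thesis by blast
qed

lemma finite_solutions:
  assumes sind: sind_principle
    and g: "\<And>i. \<exists>m. m \<preceq> g \<bullet> i \<and> (\<forall>f. app3 Y i m f = zero)"
  shows "\<exists>t. \<forall>i. i \<prec> n \<longrightarrow> t \<bullet> i \<preceq> g \<bullet> i \<and> (\<forall>f. app3 Y i (t \<bullet> i) f = zero)"
proof -
  \<comment> \<open>\<open>\<Sigma>-IND\<close> is used with the sum \<open>s\<close> as induction
    variable and \<open>n\<close> fixed. A low sequence and all its counterexamples form one
    function, so their existence is a single function quantifier.\<close>
  let ?Z = "L T1 T1 (\<lambda>f. L N N (\<lambda>s. chi (low Y n f s)))"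
  have "repf T1 T1 (\<lambda>f. L N N (\<lambda>s. chi (low Y n f s)))" "repf N N (\<lambda>s. chi (low Y n f s))" for f
    by (simp_all only: repr low_def)
  then have Z: "ap T1 T1 ?Z f \<bullet> s = zero \<longleftrightarrow> low Y n f s" for f s
    by (simp add: L_beta)
  \<comment> \<open>A solution \<open>m\<close> below \<open>g\<close> has no counterexample, so a
    low entry cannot exceed it.\<close>
  have bound: "f \<bullet> snc zero i \<preceq> g \<bullet> i" if low: "low Y n f s" and i: "i \<prec> n" for f s i
  proof -
    obtain m where m: "m \<preceq> g \<bullet> i" "\<And>f. app3 Y i m f = zero" using g by blast
    then have "\<not> m \<prec> f \<bullet> snc zero i" using low i unfolding low_def by blast
    then show ?thesis using m(1) less_linear[of m "f \<bullet> snc zero i"]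
        less_trans[of "f \<bullet> snc zero i" m "g \<bullet> i"] by metis
  qed
  have "\<not> low Y n f (suc (psum g n))" for f
  proof
    assume low: "low Y n f (suc (psum g n))"
    then obtain d where "psum g n = psum (sec f zero) n \<oplus> d"
      using psum_mono[of n "sec f zero" g] bound[OF low] by (auto simp: sec)
    then have "psum g n \<oplus> zero = psum g n \<oplus> suc d" using low unfolding low_def by simp
    then show False unfolding plus_cancel_left by (metis suc_nonzero)
  qed
  then have nall: "\<not> (\<forall>s. \<exists>f. low Y n f s)" by blast
  have "\<exists>f. low Y n f zero"
  proof -
    \<comment> \<open>All entries are zero, and no value lies below zero that would need a
      counterexample.\<close>
    let ?f = "KK N N zero"
    have "psum (sec ?f zero) n = zero"
      by (rule psum_zero, rule trans[OF sec]) simp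
    then have "low Y n ?f zero" by (simp add: low_def)
    then show ?thesis by blast
  qed
  moreover have "(\<exists>f. low Y n f zero) \<longrightarrow> (\<forall>s. (\<exists>f. low Y n f s) \<longrightarrow> (\<exists>f. low Y n f (suc s)))
      \<longrightarrow> (\<forall>s. \<exists>f. low Y n f s)"
    using sind[unfolded sind_principle_def, THEN spec, of ?Z] unfolding Z .
  \<comment> \<open>Induction would reach every sum, contrary to the bound by the sum of
    \<open>g\<close>. So it breaks down at some \<open>s\<close>, where by
    \<open>low_increment\<close> no entry admits a counterexample.\<close>
  ultimately obtain s f where f: "low Y n f s" and no: "\<nexists>f. low Y n f (suc s)"
    using nall by blast
  have "app3 Y i (f \<bullet> snc zero i) h = zero" if "i \<prec> n" for i h
    using low_increment[OF f that] no by blast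
  then show ?thesis using bound[OF f] by (intro exI[of _ "sec f zero"]) (simp add: sec)
qed

lemma enc_if_bnc_kl:
  assumes bnc_principle kl_principle and sind: sind_principle
  shows enc_principle
  unfolding enc_principle_def
proof (intro allI impI)
  fix Y assume "\<forall>n. \<exists>m. \<forall>f. app3 Y n m f = zero"
  then have "\<exists>g. \<forall>n. \<exists>m. m \<preceq> g \<bullet> n \<and> (\<forall>f. app3 Y n m f = zero)"
    by (rule assms(1)[unfolded bnc_principle_def, THEN spec, THEN mp])
  then obtain g where g': "\<forall>n. \<exists>m. m \<preceq> g \<bullet> n \<and> (\<forall>f. app3 Y n m f = zero)"
    by (rule exE)
  note g = g'[THEN spec]
  \<comment> \<open>\<open>dec b\<close> reads a function off a binary \<open>b\<close> whose zeros
    are the codes of the pairs in its graph. Every function arises in this way, so quantifying over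
    Cantor space reaches all functions.\<close>
  define dec where "dec = (\<lambda>b. L N N (\<lambda>k. pick (\<lambda>m. b \<bullet> snc k m = zero)))"
  have dec: "\<exists>b. binary b \<and> dec b = f" for f
  proof -
    let ?b = "L N N (\<lambda>z. chi (\<exists>k. z = snc k (f \<bullet> k)))"
    have b: "?b \<bullet> z = chi (\<exists>k. z = snc k (f \<bullet> k))" for z
      by (rule L_beta) (simp only: repr)
    have "dec ?b = f"
    proof (rule ap_ext[of N N])
      fix k
      have "dec ?b \<bullet> k = pick (\<lambda>m. ?b \<bullet> snc k m = zero)"
        unfolding dec_def by (rule L_beta) (simp only: repr)
      moreover have "?b \<bullet> snc k (pick (\<lambda>m. ?b \<bullet> snc k m = zero)) = zero"
        by (rule pickI[of "\<lambda>m. ?b \<bullet> snc k m = zero"]) (simp only: repr, simp add: b)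
      ultimately show "dec ?b \<bullet> k = f \<bullet> k" by (simp add: b)
    qed
    moreover have "binary ?b" unfolding binary_def b by (simp add: chi_def)
    ultimately show ?thesis by blast
  qed
  \<comment> \<open>Only the last entry \<open>x\<close> of a node is tested, its position being the
    length of \<open>s\<close>; earlier entries are tested at shorter segments. The empty sequence
    passes vacuously, and \<open>g\<close> bounds the children of each node.\<close>
  let ?G = "\<lambda>c b. chi (\<forall>s x. c = snc s x \<longrightarrow>
    x \<preceq> g \<bullet> (LEN \<bullet> s) \<and> app3 Y (LEN \<bullet> s) x (dec b) = zero)"
  let ?W = "L N T2 (\<lambda>c. L T1 N (\<lambda>b. ?G c b))"
  have W: "app2 ?W c b = ?G c b" for c b
    using [[simp_depth_limit = 1000]] unfolding dec_def by (rule L2_beta) (simp_all only: repr)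
  have ex_bin: "\<exists>b. binary b" using dec by blast
  have all_dec: "(\<forall>b. binary b \<longrightarrow> Q (dec b)) \<longleftrightarrow> (\<forall>f. Q f)" for Q
    using dec by metis
  have tree_snc: "in_tree ?W (snc s x) \<longleftrightarrow> x \<preceq> g \<bullet> (LEN \<bullet> s) \<and> (\<forall>f. app3 Y (LEN \<bullet> s) x f = zero)" for s x
  proof -
    have "in_tree ?W (snc s x) \<longleftrightarrow>
        (\<forall>b. binary b \<longrightarrow> x \<preceq> g \<bullet> (LEN \<bullet> s) \<and> app3 Y (LEN \<bullet> s) x (dec b) = zero)"
      unfolding in_tree_def W chi_eq_zero by simp
    also have "\<dots> \<longleftrightarrow> (\<forall>f. x \<preceq> g \<bullet> (LEN \<bullet> s) \<and> app3 Y (LEN \<bullet> s) x f = zero)" by (rule all_dec)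
    finally show ?thesis by blast
  qed
  have tree_zero: "in_tree ?W zero" unfolding in_tree_def W chi_eq_zero by simp
  have "\<exists>n. \<forall>m. in_tree ?W (snc c m) \<longrightarrow> m \<preceq> n" for c unfolding tree_snc by blast
  moreover have "\<exists>f. \<forall>m. m \<preceq> n \<longrightarrow> in_tree ?W (sg f m)" for n
  proof -
    obtain t where t: "\<And>i. i \<prec> n \<Longrightarrow> t \<bullet> i \<preceq> g \<bullet> i \<and> (\<forall>f. app3 Y i (t \<bullet> i) f = zero)"
      using finite_solutions[OF sind g] by blast
    have "in_tree ?W (sg t m)" if m: "m \<preceq> n" for m
    proof (cases "m = zero")
      case False
      then obtain i where i: "m = suc i" using nat_cases by blast
      then have "i \<prec> n" using m less_trans[of i "suc i" n] by (auto simp: less_suc)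
      then show ?thesis using t[of i] unfolding i sg_suc tree_snc LEN_sg by blast
    qed (use tree_zero in simp)
    then show ?thesis by blast
  qed
  ultimately have "\<exists>f. \<forall>n. in_tree ?W (sg f n)"
    by (intro assms(2)[unfolded kl_principle_def, THEN spec, THEN mp, THEN mp]) simp_all
  then obtain f where "\<forall>n. in_tree ?W (sg f n)" by (rule exE)
  \<comment> \<open>The segment of length \<open>suc n\<close> has last entry \<open>f(n)\<close> at
    position \<open>n\<close>, so its membership in the tree yields the solution at
    \<open>n\<close>.\<close>
  from this[THEN spec, of "suc _"] have "app3 Y n (f \<bullet> n) h = zero" for n h
    unfolding sg_suc tree_snc LEN_sg by blast
  then show "\<exists>g. \<forall>n f. app3 Y n (g \<bullet> n) f = zero" by blast
qed

end


section \<open>The theorem\<close>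

lemma wff_ENC: "\<phi> \<in> ENC \<Longrightarrow> wff \<phi>"
  by (auto simp: ENC_def wff_inst)

lemma wff_BNC: "\<phi> \<in> BNC \<Longrightarrow> wff \<phi>"
  by (auto simp: BNC_def wff_inst)

lemma wff_Phi1_KL: "\<phi> \<in> Phi1_KL \<Longrightarrow> wff \<phi>"
  by (auto simp: Phi1_KL_def finitely_branching_def All_Cantor_def wff_inst snoc_def seg_def)

lemma wff_Sigma_IND: "wff Sigma_IND"
  by (simp add: Sigma_IND_def Let_def)

context struct
begin

lemma aca_modelI: "models T \<Longrightarrow> ACA0w \<subseteq> T \<Longrightarrow> aca_model ap con less"
  by unfold_locales (auto simp: models_def)

lemma models_sat: "models T \<Longrightarrow> \<phi> \<in> T \<Longrightarrow> wff \<phi> \<Longrightarrow> sat e \<phi>"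
  by (simp add: models_def)

end

theorem theorem3p9: "proves_equivalence (ACA0w \<union> {Sigma_IND}) ENC (BNC \<union> Phi1_KL)"
  unfolding proves_equivalence_def
proof (intro conjI ballI)
  fix \<phi> assume \<phi>: "\<phi> \<in> BNC \<union> Phi1_KL"
  show "ACA0w \<union> {Sigma_IND} \<union> ENC \<turnstile> \<phi>"
  proof (rule completeness)
    show "wff \<phi>" using \<phi> wff_BNC wff_Phi1_KL by blast
  next
    fix ap con less e
    assume m: "struct.models ap con less (ACA0w \<union> {Sigma_IND} \<union> ENC)"
    then interpret aca_model ap con less by (rule struct.aca_modelI) blast
    have enc_principle by (rule enc_if_scheme) (use models_sat[OF m] in blast)
    then show "sat e \<phi>"
      using \<phi> scheme_if_bnc scheme_if_kl bnc_if_enc kl_if_enc by blast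
  qed (auto simp: ACA0w_def)
next
  fix \<phi> assume \<phi>: "\<phi> \<in> ENC"
  show "ACA0w \<union> {Sigma_IND} \<union> (BNC \<union> Phi1_KL) \<turnstile> \<phi>"
  proof (rule completeness)
    show "wff \<phi>" using \<phi> wff_ENC by blast
  next
    fix ap con less e
    assume m: "struct.models ap con less (ACA0w \<union> {Sigma_IND} \<union> (BNC \<union> Phi1_KL))"
    then interpret aca_model ap con less by (rule struct.aca_modelI) blast
    have bnc_principle by (rule bnc_if_scheme) (use models_sat[OF m] in blast)
    moreover have kl_principle by (rule kl_if_scheme) (use models_sat[OF m] in blast)
    moreover have sind_principle
      using models_sat[OF m _ wff_Sigma_IND] sat_Sigma_IND by blast
    ultimately have enc_principle by (rule enc_if_bnc_kl)
    then show "sat e \<phi>" using \<phi> by (rule scheme_if_enc)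
  qed (auto simp: ACA0w_def)
qed

end
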